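(* Assume that $M=+\infty$ and the function $\phi$ satisfies $$\lim_{x\to\infty}\frac{\phi(x)}{\int_x^\infty\phi(u)\,du}=c,\qquad c>0.$$ Then, as $t\to\infty$, $$\mu(t)\sim\frac1c\ln(t),\qquad\mu'(t)\sim\frac{1}{ct},$$ and $$\lim_{t\to\infty}\mathrm{Var}[S_t]=\frac{2}{c^2}.$$
   Context: Data: $\lambda>0$; $F,F_0$ are cumulative distribution functions (CDFs) on $\mathbb{R}$ (offer distribution and residual price distribution); $X\sim F$, $X_0\sim F_0$; $y_+=\max(y,0)$; $\mu_0=E[X_0]$; $M=\sup\{x : F(x)<1\}\in(-\infty,+\infty]$. Standing assumptions: $E[X_+]<\infty$, $E[|X_0|]<\infty$, $0\le\mu_0<M$. The notation $a(t)\sim b(t)$ means that $a(t)/b(t)\to1$ as $t\to\infty$. Define $\phi(x)=\int_x^\infty[1-F(u)]\,du$ and $\Psi(x)=\int_{\mu_0}^x\frac{du}{\phi(u)}$ for $x\in[\mu_0,M)$. The optimal policy is the function $\mu:[0,\infty)\to[\mu_0,M)$, $\mu(t)=\Psi^{-1}(\lambda t)$; equivalently, the solution of $\mu'(t)=\lambda\phi(\mu(t))$, $\mu(0)=\mu_0$. Bidding process with marketing period $t\ge 0$ under the optimal policy: let $D_1,D_2,\dots$ be exponential with rate $\lambda$ (inter-arrival times of offers), $X_1,X_2,\dots$ be distributed according to $F$ (offer values), and $X_0$ be distributed according to $F_0$, all independent. The time remaining to the deadline when the $i$-th offer arrives is $t_i=\max(t_{i-1}-D_i,0)$, with initial value $t$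 (that is, $t_i=(t-D_1-\dots-D_i)_+$). An offer $X_i$ with $t_i>0$ is accepted if and only if $X_i\ge\mu(t_i)$; at the first accepted offer $i$ the process ends, with realized sale price $S_t=X_i$. If no offer is accepted before the remaining time reaches $0$, then $S_t=X_0$.
   Formalization: The limit of Var[S_t] is asserted under the added assumption E[X_0^2] < ∞; without it Var[S_t] = ∞ for every t, since with probability at least exp(-λt) no offer arrives and S_t = X_0. *)

theory Defs
  imports "HOL-Probability.Probability" "HOL-Library.Landau_Symbols"
begin

definition right_endpoint :: "(real \<Rightarrow> real) \<Rightarrow> ereal" where
  "right_endpoint F = (SUP x\<in>{x. F x < 1}. ereal x)"

text \<open>The function \<open>\<phi>\<close>, the integral of \<open>1 - F\<close> over the tail. The integrand is integrable
  whenever a variable with distribution function \<open>F\<close> has an integrable positive part.\<close>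

definition tail_integral :: "(real \<Rightarrow> real) \<Rightarrow> real \<Rightarrow> real" where
  "tail_integral F x = (LBINT u:{x..}. 1 - F u)"

definition Psi :: "(real \<Rightarrow> real) \<Rightarrow> real \<Rightarrow> real \<Rightarrow> real" where
  "Psi F \<mu>\<^sub>0 x = (LBINT u:{\<mu>\<^sub>0..x}. 1 / tail_integral F u)"

text \<open>The inverse is that of \<open>Psi F \<mu>\<^sub>0\<close> restricted to the half-open interval from \<open>\<mu>\<^sub>0\<close> to
  the (possibly infinite) right endpoint of \<open>F\<close>.\<close>

definition optimal_policy :: "real \<Rightarrow> (real \<Rightarrow> real) \<Rightarrow> real \<Rightarrow> real \<Rightarrow> real" where
  "optimal_policy r F \<mu>\<^sub>0 t =
     the_inv_into {x. \<mu>\<^sub>0 \<le> x \<and> ereal x < right_endpoint F} (Psi F \<mu>\<^sub>0) (r * t)"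

text \<open>The definitions below describe one realization of the bidding process with marketing
  period \<open>t\<close> under a policy \<open>\<mu>\<close>. Offers are numbered from \<open>1\<close>: \<open>d i\<close> is the time between
  offers \<open>i - 1\<close> and \<open>i\<close>, and \<open>x i\<close> is the value of offer \<open>i\<close>. The value \<open>d 0\<close> is not used,
  and \<open>x 0\<close> is the residual price.\<close>

fun time_left :: "(nat \<Rightarrow> real) \<Rightarrow> real \<Rightarrow> nat \<Rightarrow> real" where
  "time_left d t 0 = t"
| "time_left d t (Suc i) = max (time_left d t i - d (Suc i)) 0"

definition acceptable ::
  "(real \<Rightarrow> real) \<Rightarrow> (nat \<Rightarrow> real) \<Rightarrow> (nat \<Rightarrow> real) \<Rightarrow> real \<Rightarrow> nat \<Rightarrow> bool" where
  "acceptable \<mu> d x t i \<longleftrightarrow> 1 \<le> i \<and> 0 < time_left d t i \<and> \<mu> (time_left d t i) \<le> x i"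

definition sale_price ::
  "(real \<Rightarrow> real) \<Rightarrow> (nat \<Rightarrow> real) \<Rightarrow> (nat \<Rightarrow> real) \<Rightarrow> real \<Rightarrow> real" where
  "sale_price \<mu> d x t =
     (if \<exists>i. acceptable \<mu> d x t i then x (LEAST i. acceptable \<mu> d x t i) else x 0)"

end

theory Submission
  imports Defs
begin

text \<open>Write \<open>\<phi>\<close> for the integrated tail \<open>tail_integral F\<close> and \<open>\<Phi> x\<close> for the integral of \<open>\<phi>\<close> over \<open>[x, \<infinity>)\<close>.
By Fubini, \<open>\<phi> x\<close> is the mean of \<open>(X - x)\<^sub>+\<close> and \<open>2 \<Phi> x\<close> is its second moment. The policy satisfies
\<open>\<mu>' = r \<phi>(\<mu>)\<close>, where \<open>r\<close> is the arrival rate.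

\<^emph>\<open>The policy.\<close> As \<open>\<Phi>' = - \<phi>\<close>, the function \<open>1 / \<Phi>(\<mu> t)\<close> has the derivative
\<open>r (\<phi> / \<Phi>)\<^sup>2 (\<mu> t)\<close>, which tends to \<open>r c\<^sup>2\<close>. By l'Hospital's rule \<open>t \<Phi>(\<mu> t) \<longlonglongrightarrow> 1 / (r c\<^sup>2)\<close>, and after
multiplication with \<open>\<phi> / \<Phi>\<close> also \<open>t \<phi>(\<mu> t) \<longlonglongrightarrow> 1 / (r c)\<close> (\<open>tail_along_policy\<close>). This is the claim on
\<open>\<mu>'\<close>, and one more application of l'Hospital's rule gives the claim on \<open>\<mu>\<close>.

\<^emph>\<open>The moments.\<close> Suppose that \<open>V 0\<close> is the mean of \<open>h(X\<^sub>0)\<close> and that \<open>V' s\<close> is \<open>r\<close> times the mean of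
\<open>h(X) - V s\<close> on the event \<open>X \<ge> \<mu> s\<close>. Then the reward already received plus \<open>V\<close> at the remaining time
is a martingale along the offers, and therefore \<open>V t\<close> is the mean of \<open>h(S\<^sub>t)\<close>
(\<open>expectation_sale_price\<close>). For \<open>h(x) = x\<close> the candidate is \<open>\<mu>\<close> itself, because the mean of \<open>X - \<mu> s\<close> on
\<open>X \<ge> \<mu> s\<close> is \<open>\<phi>(\<mu> s)\<close>. For \<open>h(x) = x\<^sup>2\<close> the candidate \<open>\<mu>\<^sup>2 + v\<close> leads to
\<open>v' = 2 r \<Phi>(\<mu>) - r v P(X \<ge> \<mu>)\<close>. As \<open>\<phi>' = - P(X > \<cdot>)\<close>, this linear equation has the integrating factor
\<open>1 / \<phi>(\<mu>)\<close>, and the solution that starts in the variance \<open>v\<^sub>0\<close> of \<open>X\<^sub>0\<close> is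
\<open>v t = \<phi>(\<mu> t) (v\<^sub>0 / \<phi>(\<mu>\<^sub>0) + \<integral>\<^sub>0\<^sup>t 2 r \<Phi>(\<mu> s) / \<phi>(\<mu> s) ds)\<close>. The integrand tends to \<open>2 r / c\<close>, so \<open>v t\<close> tends to
\<open>1 / (r c) \<cdot> 2 r / c = 2 / c\<^sup>2\<close>, whatever \<open>v\<^sub>0\<close> is.

The distribution of the offers may have atoms. At these \<open>\<phi>\<close> has a kink, so that the equation for \<open>v\<close>
holds outside a countable set only; the fundamental theorem of calculus is therefore proved with
countably many exceptions.\<close>

section \<open>Calculus off a countable set\<close>

text \<open>If \<open>f\<close> increased, tilting it by a small slope \<open>e\<close> would keep the increase. Every intermediate level is
then attained for the last time at a point where the tilted function cannot have the derivative \<open>- e\<close>.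
These points lie in the exceptional set, but there are uncountably many levels.\<close>

lemma zero_derivative_off_countable_nonincreasing:
  fixes f :: "real \<Rightarrow> real"
  assumes "a \<le> b" and cont: "continuous_on {a..b} f" and "countable C"
    and deriv: "\<And>x. x \<in> {a<..<b} - C \<Longrightarrow> (f has_real_derivative 0) (at x)"
  shows "f b \<le> f a"
proof (rule ccontr)
  assume "\<not> f b \<le> f a"
  with \<open>a \<le> b\<close> have "a < b" and up: "f a < f b"
    by (auto simp: not_le order.order_iff_strict)
  define e where "e = (f b - f a) / 2 / (b - a)"
  define g where "g = (\<lambda>x. f x - f a - e * (x - a))"
  have "e > 0" using up \<open>a < b\<close> by (simp add: e_def)
  have ga: "g a = 0" by (simp add: g_def)
  have "e * (b - a) = (f b - f a) / 2"
    unfolding e_def by (rule nonzero_eq_divide_eq[THEN iffD1, OF _ refl]) (use \<open>a < b\<close> in simp)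
  with up have gb: "g b > 0" by (simp add: g_def)
  have contg: "continuous_on {a..b} g"
    unfolding g_def by (intro continuous_intros cont)
  have "\<exists>x\<in>C. g x = y" if y: "y \<in> {0<..<g b}" for y
  proof -
    define L where "L = {x \<in> {a..b}. g x = y}"
    have "\<exists>x\<ge>a. x \<le> b \<and> g x = y"
      using y ga \<open>a \<le> b\<close> by (intro IVT' contg) auto
    hence "L \<noteq> {}" by (auto simp: L_def)
    moreover have "compact L"
    proof -
      have "closed L"
        unfolding L_def by (intro continuous_closed_preimage_constant contg) simp
      moreover have "bounded L"
        by (rule bounded_subset[of "{a..b}"]) (auto simp: L_def)
      ultimately show ?thesis by (simp add: compact_eq_bounded_closed)
    qed
    ultimately obtain s where s: "s \<in> L" "\<And>x. x \<in> L \<Longrightarrow> x \<le> s"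
      using compact_attains_sup by metis
    have gs: "g s = y" using s(1) by (simp add: L_def)
    have sab: "a < s" "s < b"
      using s(1) y ga by (auto simp: L_def order.order_iff_strict)
    have "s \<in> C"
    proof (rule ccontr)
      assume "s \<notin> C"
      with sab have "(f has_real_derivative 0) (at s)" by (intro deriv) auto
      hence "(g has_real_derivative - e) (at s)"
        unfolding g_def by (auto intro!: derivative_eq_intros)
      from DERIV_neg_dec_right[OF this] \<open>e > 0\<close>
      obtain d where d: "d > 0" "\<And>h. h > 0 \<Longrightarrow> h < d \<Longrightarrow> g (s + h) < g s" by auto
      define h where "h = min d (b - s) / 2"
      have h: "h > 0" "h < d" "s + h < b"
        using d(1) sab by (auto simp: h_def min_def field_simps)
      have "\<exists>x\<ge>s+h. x \<le> b \<and> g x = y"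
        using d(2)[OF h(1,2)] gs y h sab
        by (intro IVT' continuous_on_subset[OF contg]) auto
      then obtain x where "x \<ge> s + h" "x \<le> b" "g x = y" by auto
      with s(2)[of x] h sab show False by (auto simp: L_def)
    qed
    with gs show ?thesis by blast
  qed
  hence "{0<..<g b} \<subseteq> g ` C" by blast
  hence "countable {0<..<g b}"
    using countable_image[OF \<open>countable C\<close>] by (rule countable_subset)
  with gb show False
    using uncountable_open_interval[of 0 "g b"] by simp
qed

lemma fundamental_theorem_of_calculus_countable:
  fixes f f' :: "real \<Rightarrow> real"
  assumes "a \<le> b" and cont: "continuous_on {a..b} f" and "countable C"
    and int: "f' integrable_on {a..b}"
    and deriv: "\<And>x. x \<in> {a<..<b} - C \<Longrightarrow> (f has_real_derivative f' x) (at x)"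
    and cont': "\<And>x. x \<in> {a<..<b} - C \<Longrightarrow> isCont f' x"
  shows "(f' has_integral (f b - f a)) {a..b}"
proof -
  \<comment> \<open>the primitive and \<open>f\<close> have the same derivative off \<open>C\<close>, so they differ by a constant\<close>
  define L where "L = (\<lambda>u. integral {a..u} f')"
  have contL: "continuous_on {a..b} L"
    unfolding L_def by (rule indefinite_integral_continuous_1[OF int])
  have derivL: "(L has_real_derivative f' x) (at x)" if x: "x \<in> {a<..<b} - C" for x
  proof -
    have "((\<lambda>u. integral {a..u} f') has_vector_derivative f' x) (at x within ({a..b} - {}))"
      using x cont'[OF x] by (intro integral_has_vector_derivative_continuous_at int)
        (auto intro: continuous_at_imp_continuous_at_within)
    thus ?thesis
      using x by (simp add: L_def has_real_derivative_iff_has_vector_derivative at_within_Icc_at)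
  qed
  have "f b - L b \<le> f a - L a"
  proof (rule zero_derivative_off_countable_nonincreasing[OF \<open>a \<le> b\<close> _ \<open>countable C\<close>])
    show "continuous_on {a..b} (\<lambda>x. f x - L x)" by (intro continuous_intros cont contL)
    show "((\<lambda>x. f x - L x) has_real_derivative 0) (at x)" if "x \<in> {a<..<b} - C" for x
      using DERIV_diff[OF deriv[OF that] derivL[OF that]] by simp
  qed
  moreover have "L b - f b \<le> L a - f a"
  proof (rule zero_derivative_off_countable_nonincreasing[OF \<open>a \<le> b\<close> _ \<open>countable C\<close>])
    show "continuous_on {a..b} (\<lambda>x. L x - f x)" by (intro continuous_intros cont contL)
    show "((\<lambda>x. L x - f x) has_real_derivative 0) (at x)" if "x \<in> {a<..<b} - C" for x
      using DERIV_diff[OF derivL[OF that] deriv[OF that]] by simp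
  qed
  moreover have "L a = 0" by (simp add: L_def)
  ultimately have "L b = f b - f a" by simp
  thus ?thesis
    using int unfolding L_def by (metis integrable_integral)
qed

text \<open>This serves both for \<open>\<phi>\<close>, with \<open>f\<close> the survival function, and for \<open>\<Phi>\<close>, with \<open>f = \<phi>\<close>. As the survival
function may jump, the derivative is taken at one point of continuity.\<close>

lemma tail_integral_has_derivative:
  fixes f :: "real \<Rightarrow> real"
  assumes int: "\<And>a. set_integrable lborel {a..} f" and "isCont f x"
  shows "((\<lambda>x. LBINT u:{x..}. f u) has_real_derivative - f x) (at x)"
proof -
  define a where "a = x - 1"
  define b where "b = x + 1"
  have eq: "(LBINT u:{y..}. f u) = (LBINT u:{a..}. f u) - integral {a..y} f"
    if "y \<in> {a<..<b}" for y
  proof -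
    have ay: "set_integrable lborel {a..<y} f" "set_integrable lborel {a..y} f"
      by (rule set_integrable_subset[OF int[of a]]; auto)+
    have "(LBINT u:{a..}. f u) = (LBINT u:{a..<y} \<union> {y..}. f u)"
      using that by (intro arg_cong[where f = "\<lambda>A. LBINT u:A. f u"]) auto
    also have "\<dots> = (LBINT u:{a..<y}. f u) + (LBINT u:{y..}. f u)"
      by (intro set_integral_Un ay int) auto
    also have "(LBINT u:{a..<y}. f u) = (LBINT u:{a..y}. f u)"
      by (rule set_integral_cong_set)
        (use ay AE_lborel_singleton[of y] in
          \<open>auto simp: set_borel_measurable_def set_integrable_def elim!: eventually_mono\<close>)
    also have "\<dots> = integral {a..y} f"
      by (rule set_borel_integral_eq_integral(2)[OF ay(2)])
    finally show ?thesis by simp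
  qed
  have "set_integrable lborel {a..b} f"
    by (rule set_integrable_subset[OF int[of a]]) auto
  hence "f integrable_on {a..b}" by (rule set_borel_integral_eq_integral)
  hence "((\<lambda>u. integral {a..u} f) has_vector_derivative f x) (at x within ({a..b} - {}))"
    using assms(2) by (intro integral_has_vector_derivative_continuous_at)
      (auto intro: continuous_at_imp_continuous_at_within simp: a_def b_def)
  hence "((\<lambda>u. integral {a..u} f) has_real_derivative f x) (at x)"
    by (simp add: has_real_derivative_iff_has_vector_derivative at_within_Icc_at a_def b_def)
  hence "((\<lambda>u. (LBINT u:{a..}. f u) - integral {a..u} f) has_real_derivative - f x) (at x)"
    by (auto intro!: derivative_eq_intros)
  thus ?thesis
    by (rule has_field_derivative_transform_within_open[where S = "{a<..<b}"])
      (auto simp: eq, auto simp: a_def b_def)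
qed

lemma set_integral_eq_if_nn_integral_eq:
  fixes f :: "real \<Rightarrow> real"
  assumes [measurable]: "f \<in> borel_measurable borel" "A \<in> sets borel"
    and "\<And>u. 0 \<le> f u" "0 \<le> I"
    and "(\<integral>\<^sup>+u. ennreal (f u) * indicator A u \<partial>lborel) = ennreal I"
  shows "set_integrable lborel A f" "(LBINT u:A. f u) = I"
proof -
  have "(\<integral>\<^sup>+u. ennreal (indicator A u *\<^sub>R f u) \<partial>lborel) = ennreal I"
    using assms(5) by (auto simp: indicator_def intro!: nn_integral_cong elim!: trans[rotated])
  hence "integrable lborel (\<lambda>u. indicator A u *\<^sub>R f u) \<and> (\<integral>u. indicator A u *\<^sub>R f u \<partial>lborel) = I"
    using assms(3,4) by (subst nn_integral_eq_integrable[symmetric]) auto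
  thus "set_integrable lborel A f" "(LBINT u:A. f u) = I"
    by (auto simp: set_integrable_def set_lebesgue_integral_def)
qed

section \<open>Integrated tails of the offer distribution\<close>

locale unbounded_offers = real_distribution N for N :: "real measure" +
  assumes integrable_positive_part: "integrable N (\<lambda>y. max y 0)"
    and tail_pos: "\<And>x. 0 < measure N {x<..}"
begin

abbreviation \<phi> :: "real \<Rightarrow> real" where
  "\<phi> \<equiv> tail_integral (cdf N)"

abbreviation \<Phi> :: "real \<Rightarrow> real" where
  "\<Phi> x \<equiv> (LBINT u:{x..}. \<phi> u)"

lemma one_minus_cdf: "1 - cdf N u = measure N {u<..}"
proof -
  have "measure N (space N - {..u}) = 1 - measure N {..u}"
    by (intro prob_compl) auto
  moreover have "space N - {..u} = {u<..}" by auto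
  ultimately show ?thesis by (simp add: cdf_def)
qed

text \<open>Both moment formulas below are instances of this exchange: the inner integral over \<open>u \<ge> x\<close> turns the
indicator of \<open>u < y\<close> into \<open>(y - x)\<^sub>+\<close>, and \<open>(y - u)\<^sub>+\<close> into \<open>(y - x)\<^sub>+\<^sup>2 / 2\<close>.\<close>

lemma tail_integral_swap:
  fixes f :: "real \<Rightarrow> real \<Rightarrow> ennreal"
  assumes [measurable]: "case_prod f \<in> borel_measurable (borel \<Otimes>\<^sub>M borel)"
  shows "(\<integral>\<^sup>+u. (\<integral>\<^sup>+y. f u y \<partial>N) * indicator {x..} u \<partial>lborel) =
         (\<integral>\<^sup>+y. (\<integral>\<^sup>+u. f u y * indicator {x..} u \<partial>lborel) \<partial>N)"
proof -
  interpret pair_sigma_finite lborel N ..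
  have "(\<integral>\<^sup>+u. (\<integral>\<^sup>+y. f u y \<partial>N) * indicator {x..} u \<partial>lborel) =
        (\<integral>\<^sup>+u. (\<integral>\<^sup>+y. f u y * indicator {x..} u \<partial>N) \<partial>lborel)"
    by (intro nn_integral_cong nn_integral_multc[symmetric]) measurable
  also have "\<dots> = (\<integral>\<^sup>+y. (\<integral>\<^sup>+u. f u y * indicator {x..} u \<partial>lborel) \<partial>N)"
    by (rule Fubini'[symmetric]) measurable
  finally show ?thesis .
qed

lemma integrable_excess: "integrable N (\<lambda>y. max (y - x) 0)"
proof (rule Bochner_Integration.integrable_bound)
  show "integrable N (\<lambda>y. max y 0 + \<bar>x\<bar>)"
    by (intro Bochner_Integration.integrable_add integrable_positive_part) simp
qed (auto simp: max_def)

lemma survival_integrable: "set_integrable lborel {x..} (\<lambda>u. 1 - cdf N u)"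
  and tail_integral_eq_expectation: "\<phi> x = (\<integral>y. max (y - x) 0 \<partial>N)"
proof -
  have [measurable]: "cdf N \<in> borel_measurable borel"
    by (rule borel_measurable_mono) (auto intro!: monoI cdf_nondecreasing)
  have "(\<integral>\<^sup>+u. ennreal (1 - cdf N u) * indicator {x..} u \<partial>lborel) =
        (\<integral>\<^sup>+u. (\<integral>\<^sup>+y. indicator {p. fst p < snd p} (u, y) \<partial>N) * indicator {x..} u \<partial>lborel)"
  proof (intro nn_integral_cong)
    fix u :: real
    have "(\<integral>\<^sup>+y. indicator {p. fst p < snd p} (u, y) \<partial>N) = (\<integral>\<^sup>+y. indicator {u<..} y \<partial>N)"
      by (intro nn_integral_cong) (auto simp: indicator_def)
    also have "\<dots> = ennreal (1 - cdf N u)"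
      by (simp add: one_minus_cdf emeasure_eq_measure)
    finally show "ennreal (1 - cdf N u) * indicator {x..} u =
      (\<integral>\<^sup>+y. indicator {p. fst p < snd p} (u, y) \<partial>N) * indicator {x..} u" by simp
  qed
  also have "\<dots> = (\<integral>\<^sup>+y. (\<integral>\<^sup>+u. indicator {p. fst p < snd p} (u, y) * indicator {x..} u \<partial>lborel) \<partial>N)"
    by (rule tail_integral_swap)
      (auto simp: borel_prod intro!: borel_measurable_indicator borel_open open_Collect_less
        continuous_intros)
  also have "\<dots> = (\<integral>\<^sup>+y. ennreal (max (y - x) 0) \<partial>N)"
  proof (intro nn_integral_cong)
    fix y :: real
    have "(\<integral>\<^sup>+u. indicator {p. fst p < snd p} (u, y) * indicator {x..} u \<partial>lborel) =
          (\<integral>\<^sup>+u. indicator {x..<y} u \<partial>lborel)"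
      by (intro nn_integral_cong) (auto simp: indicator_def)
    thus "(\<integral>\<^sup>+u. indicator {p. fst p < snd p} (u, y) * indicator {x..} u \<partial>lborel) =
          ennreal (max (y - x) 0)"
      by (cases "x \<le> y") auto
  qed
  also have "\<dots> = ennreal (\<integral>y. max (y - x) 0 \<partial>N)"
    by (intro nn_integral_eq_integral integrable_excess) auto
  finally have eq: "(\<integral>\<^sup>+u. ennreal (1 - cdf N u) * indicator {x..} u \<partial>lborel) =
    ennreal (\<integral>y. max (y - x) 0 \<partial>N)" .
  show "set_integrable lborel {x..} (\<lambda>u. 1 - cdf N u)" "\<phi> x = (\<integral>y. max (y - x) 0 \<partial>N)"
    using set_integral_eq_if_nn_integral_eq[OF _ _ _ _ eq]
    by (auto simp: cdf_bounded_prob tail_integral_def)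
qed

lemma tail_integral_pos: "0 < \<phi> x"
proof -
  have "(\<integral>y. max (y - x) 0 \<partial>N) \<noteq> 0"
  proof
    assume "(\<integral>y. max (y - x) 0 \<partial>N) = 0"
    hence "AE y in N. max (y - x) 0 = 0"
      by (subst (asm) integral_nonneg_eq_0_iff_AE) (auto intro: integrable_excess)
    hence "AE y in N. y \<notin> {x<..}" by (auto elim!: eventually_mono simp: max_def split: if_splits)
    hence "measure N {x<..} = 0"
      by (subst (asm) AE_iff_measurable[of "{x<..}"]) (auto simp: measure_def)
    with tail_pos[of x] show False by simp
  qed
  moreover have "(\<integral>y. max (y - x) 0 \<partial>N) \<ge> 0" by (intro Bochner_Integration.integral_nonneg) auto
  ultimately show ?thesis unfolding tail_integral_eq_expectation by linarith
qed

lemma tail_integral_antimono: "x \<le> y \<Longrightarrow> \<phi> y \<le> \<phi> x"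
  unfolding tail_integral_eq_expectation
  by (intro integral_mono integrable_excess) auto

lemma tail_integral_lipschitz: "\<bar>\<phi> x - \<phi> y\<bar> \<le> \<bar>x - y\<bar>"
proof -
  have "\<bar>\<phi> x - \<phi> y\<bar> = \<bar>\<integral>z. max (z - x) 0 - max (z - y) 0 \<partial>N\<bar>"
    unfolding tail_integral_eq_expectation
    by (simp add: Bochner_Integration.integral_diff integrable_excess)
  also have "\<dots> \<le> (\<integral>z. \<bar>max (z - x) 0 - max (z - y) 0\<bar> \<partial>N)"
    by (rule integral_abs_bound)
  also have "\<dots> \<le> (\<integral>z. \<bar>x - y\<bar> \<partial>N)"
    by (intro integral_mono integrable_abs Bochner_Integration.integrable_diff integrable_excess)
      auto
  also have "\<dots> = \<bar>x - y\<bar>" using prob_space by simp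
  finally show ?thesis .
qed

lemma continuous_on_tail_integral: "continuous_on S \<phi>"
proof -
  have "1-lipschitz_on S \<phi>"
    using tail_integral_lipschitz by (intro lipschitz_onI) (auto simp: dist_real_def)
  thus ?thesis by (rule lipschitz_on_continuous_on)
qed

lemma isCont_tail_integral: "isCont \<phi> x"
  using continuous_on_tail_integral[of UNIV] by (simp add: continuous_on_eq_continuous_at)

lemma tail_integral_deriv:
  assumes "isCont (cdf N) x"
  shows "(\<phi> has_real_derivative - measure N {x<..}) (at x)"
proof -
  have "((\<lambda>x. LBINT u:{x..}. 1 - cdf N u) has_real_derivative - (1 - cdf N x)) (at x)"
    by (rule tail_integral_has_derivative[OF survival_integrable])
      (intro continuous_intros assms)
  thus ?thesis by (simp add: tail_integral_def[abs_def] one_minus_cdf)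
qed

text \<open>The acceptance probability is \<open>P(X \<ge> x)\<close>, whereas \<open>\<phi>\<close> differentiates to \<open>- P(X > x)\<close>. The two agree, and
the former is continuous, wherever the distribution function is.\<close>

lemma isCont_closed_tail:
  assumes "isCont (cdf N) x"
  shows "isCont (\<lambda>y. measure N {y..}) x" "measure N {x..} = measure N {x<..}"
proof -
  have "measure N {x} = 0" using assms by (simp add: isCont_cdf)
  moreover have "measure N ({x} \<union> {x<..}) = measure N {x} + measure N {x<..}"
    by (intro finite_measure_Union) auto
  moreover have "{x} \<union> {x<..} = {x..}" by auto
  ultimately show eq: "measure N {x..} = measure N {x<..}" by simp
  show "isCont (\<lambda>y. measure N {y..}) x"
    unfolding isCont_def eq one_minus_cdf[symmetric]
  proof (rule tendsto_sandwich)
    show "\<forall>\<^sub>F y in at x. 1 - cdf N y \<le> measure N {y..}"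
      unfolding one_minus_cdf by (intro always_eventually allI finite_measure_mono) auto
    \<comment> \<open>a point strictly below \<open>y\<close> that still tends to \<open>x\<close>\<close>
    show "\<forall>\<^sub>F y in at x. measure N {y..} \<le> 1 - cdf N (y - \<bar>y - x\<bar>)"
      unfolding one_minus_cdf eventually_at_filter
      by (intro always_eventually allI impI finite_measure_mono) auto
    show "((\<lambda>y. 1 - cdf N y) \<longlongrightarrow> 1 - cdf N x) (at x)"
      using assms by (intro tendsto_intros) (simp add: isCont_def)
    have "((\<lambda>y. y - \<bar>y - x\<bar>) \<longlongrightarrow> x - \<bar>x - x\<bar>) (at x)"
      by (intro tendsto_intros)
    hence "((\<lambda>y. cdf N (y - \<bar>y - x\<bar>)) \<longlongrightarrow> cdf N x) (at x)"
      by (intro isCont_tendsto_compose[OF assms]) simp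
    thus "((\<lambda>y. 1 - cdf N (y - \<bar>y - x\<bar>)) \<longlongrightarrow> 1 - cdf N x) (at x)"
      by (intro tendsto_intros)
  qed
qed

lemma tail_integral_set_integrable:
  assumes "set_integrable lborel {a..} \<phi>"
  shows "set_integrable lborel {x..} \<phi>"
proof -
  have "set_integrable lborel ({x..max x a} \<union> {max x a..}) \<phi>"
    by (intro set_integrable_Un borel_integrable_atLeastAtMost' continuous_on_tail_integral
        set_integrable_subset[OF assms]) auto
  moreover have "{x..max x a} \<union> {max x a..} = {x..}" by auto
  ultimately show ?thesis by simp
qed

lemma
  assumes "set_integrable lborel {a..} \<phi>"
  shows integrable_excess_square: "integrable N (\<lambda>y. (max (y - x) 0)\<^sup>2)"
    and expectation_excess_square: "(\<integral>y. (max (y - x) 0)\<^sup>2 \<partial>N) = 2 * \<Phi> x"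
    and double_tail_pos: "0 < \<Phi> x"
proof -
  have int: "set_integrable lborel {x..} \<phi>" by (rule tail_integral_set_integrable[OF assms])
  have nonneg: "0 \<le> \<Phi> x"
    unfolding set_lebesgue_integral_def using tail_integral_pos
    by (intro Bochner_Integration.integral_nonneg) (auto simp: less_imp_le)
  have "ennreal (\<Phi> x) = (\<integral>\<^sup>+u. ennreal (indicator {x..} u *\<^sub>R \<phi> u) \<partial>lborel)"
    using int tail_integral_pos unfolding set_lebesgue_integral_def set_integrable_def
    by (intro nn_integral_eq_integral[symmetric]) (auto simp: less_imp_le)
  also have "\<dots> = (\<integral>\<^sup>+u. (\<integral>\<^sup>+y. ennreal (max (y - u) 0) \<partial>N) * indicator {x..} u \<partial>lborel)"
  proof (intro nn_integral_cong)
    fix u :: real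
    have "(\<integral>\<^sup>+y. ennreal (max (y - u) 0) \<partial>N) = ennreal (\<phi> u)"
      unfolding tail_integral_eq_expectation
      by (intro nn_integral_eq_integral integrable_excess) auto
    thus "ennreal (indicator {x..} u *\<^sub>R \<phi> u) =
        (\<integral>\<^sup>+y. ennreal (max (y - u) 0) \<partial>N) * indicator {x..} u"
      by (auto simp: indicator_def)
  qed
  also have "\<dots> = (\<integral>\<^sup>+y. (\<integral>\<^sup>+u. ennreal (max (y - u) 0) * indicator {x..} u \<partial>lborel) \<partial>N)"
    by (rule tail_integral_swap) measurable
  also have "\<dots> = (\<integral>\<^sup>+y. ennreal ((max (y - x) 0)\<^sup>2 / 2) \<partial>N)"
  proof (intro nn_integral_cong)
    fix y :: real
    show "(\<integral>\<^sup>+u. ennreal (max (y - u) 0) * indicator {x..} u \<partial>lborel) =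
          ennreal ((max (y - x) 0)\<^sup>2 / 2)"
    proof (cases "x \<le> y")
      case True
      have "(\<integral>\<^sup>+u. ennreal (max (y - u) 0) * indicator {x..} u \<partial>lborel) =
            (\<integral>\<^sup>+u. ennreal (y - u) * indicator {x..y} u \<partial>lborel)"
        by (intro nn_integral_cong) (auto simp: indicator_def max_def)
      also have "\<dots> = ennreal (- ((y - y)\<^sup>2 / 2) - - ((y - x)\<^sup>2 / 2))"
        using True by (intro nn_integral_FTC_Icc) (auto intro!: derivative_eq_intros simp: field_simps)
      finally show ?thesis using True by (simp add: max_def)
    next
      case False
      hence "(\<integral>\<^sup>+u. ennreal (max (y - u) 0) * indicator {x..} u \<partial>lborel) = (\<integral>\<^sup>+u. 0 \<partial>(lborel :: real measure))"
        by (intro nn_integral_cong) (auto simp: indicator_def max_def)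
      thus ?thesis using False by (simp add: max_def)
    qed
  qed
  finally have half: "integrable N (\<lambda>y. (max (y - x) 0)\<^sup>2 / 2) \<and> (\<integral>y. (max (y - x) 0)\<^sup>2 / 2 \<partial>N) = \<Phi> x"
    using nonneg by (subst nn_integral_eq_integrable[symmetric]) auto
  hence "integrable N (\<lambda>y. 2 * ((max (y - x) 0)\<^sup>2 / 2))"
    by (intro integrable_mult_right) auto
  thus "integrable N (\<lambda>y. (max (y - x) 0)\<^sup>2)" by simp
  show "(\<integral>y. (max (y - x) 0)\<^sup>2 \<partial>N) = 2 * \<Phi> x" using half by simp
  have "\<Phi> x \<noteq> 0"
  proof
    assume "\<Phi> x = 0"
    hence "AE u in lborel. indicator {x..} u *\<^sub>R \<phi> u = 0"
      using int tail_integral_pos unfolding set_lebesgue_integral_def set_integrable_def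
      by (subst (asm) integral_nonneg_eq_0_iff_AE) (auto simp: less_imp_le)
    hence "AE u in lborel. u \<notin> {x..}"
      by (rule eventually_mono) (use tail_integral_pos in \<open>auto simp: indicator_def less_le\<close>)
    hence "emeasure lborel {x..} = 0"
      by (subst (asm) AE_iff_measurable[of "{x..}"]) auto
    moreover have "emeasure lborel {x..x+1} \<le> emeasure lborel {x..}"
      by (intro emeasure_mono) auto
    ultimately show False by simp
  qed
  with nonneg show "0 < \<Phi> x" by simp
qed

lemma double_tail_deriv:
  assumes "set_integrable lborel {a..} \<phi>"
  shows "(\<Phi> has_real_derivative - \<phi> x) (at x)"
  by (rule tail_integral_has_derivative[OF tail_integral_set_integrable[OF assms]
        isCont_tail_integral])

end

section \<open>The optimal policy as the flow of the integrated tail\<close>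

locale bidding_policy = unbounded_offers N for N :: "real measure" +
  fixes \<mu>\<^sub>0 r :: real
  assumes rate_pos: "0 < r" and unbounded: "right_endpoint (cdf N) = \<infinity>"
begin

abbreviation \<mu> :: "real \<Rightarrow> real" where
  "\<mu> \<equiv> optimal_policy r (cdf N) \<mu>\<^sub>0"

abbreviation \<Psi> :: "real \<Rightarrow> real" where
  "\<Psi> \<equiv> Psi (cdf N) \<mu>\<^sub>0"

lemma continuous_on_inverse_tail: "continuous_on S (\<lambda>u. 1 / \<phi> u)"
  using tail_integral_pos
  by (intro continuous_intros continuous_on_tail_integral) (auto simp: less_le)

lemma Psi_eq_integral: "\<Psi> x = integral {\<mu>\<^sub>0..x} (\<lambda>u. 1 / \<phi> u)"
  unfolding Psi_def
  by (intro set_borel_integral_eq_integral borel_integrable_atLeastAtMost'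
      continuous_on_inverse_tail)

lemma Psi_lower: "\<Psi> \<mu>\<^sub>0 = 0"
  by (simp add: Psi_eq_integral)

text \<open>As \<open>1 / \<phi>\<close> is bounded below by its value at \<open>\<mu>\<^sub>0\<close>, the function \<open>\<Psi>\<close> grows at least linearly. This one
estimate makes \<open>\<Psi>\<close> injective and unbounded, and its inverse Lipschitz.\<close>

lemma Psi_increase:
  assumes "\<mu>\<^sub>0 \<le> x" "x \<le> y"
  shows "(y - x) / \<phi> \<mu>\<^sub>0 \<le> \<Psi> y - \<Psi> x"
proof -
  have int: "(\<lambda>u. 1 / \<phi> u) integrable_on {a..b}" for a b
    by (intro integrable_continuous_real continuous_on_inverse_tail)
  have "(y - x) / \<phi> \<mu>\<^sub>0 = integral {x..y} (\<lambda>u. 1 / \<phi> \<mu>\<^sub>0)"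
    using assms by simp
  also have "\<dots> \<le> integral {x..y} (\<lambda>u. 1 / \<phi> u)"
    using assms tail_integral_pos tail_integral_antimono
    by (intro integral_le int integrable_const_ivl divide_left_mono) auto
  also have "\<dots> = \<Psi> y - \<Psi> x"
    using Henstock_Kurzweil_Integration.integral_combine[OF assms int] by (simp add: Psi_eq_integral)
  finally show ?thesis .
qed

lemma Psi_strict_mono: "\<mu>\<^sub>0 \<le> x \<Longrightarrow> x < y \<Longrightarrow> \<Psi> x < \<Psi> y"
  using Psi_increase[of x y] tail_integral_pos[of "\<mu>\<^sub>0"]
  by (smt (verit) divide_pos_pos)

lemma Psi_deriv:
  assumes "\<mu>\<^sub>0 < x"
  shows "(\<Psi> has_real_derivative 1 / \<phi> x) (at x)"
proof -
  have "((\<lambda>x. integral {\<mu>\<^sub>0..x} (\<lambda>u. 1 / \<phi> u)) has_real_derivative 1 / \<phi> x)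
          (at x within {\<mu>\<^sub>0..x+1})"
    using assms by (intro integral_has_real_derivative continuous_on_inverse_tail) auto
  thus ?thesis using assms by (simp add: at_within_Icc_at Psi_eq_integral[abs_def])
qed

lemma policy_domain: "{x. \<mu>\<^sub>0 \<le> x \<and> ereal x < right_endpoint (cdf N)} = {\<mu>\<^sub>0..}"
  by (auto simp: unbounded)

lemma inj_on_Psi: "inj_on \<Psi> {\<mu>\<^sub>0..}"
proof (rule inj_onI)
  fix x y assume "x \<in> {\<mu>\<^sub>0..}" "y \<in> {\<mu>\<^sub>0..}" "\<Psi> x = \<Psi> y"
  thus "x = y" using Psi_strict_mono[of x y] Psi_strict_mono[of y x] by (cases x y rule: linorder_cases) auto
qed

lemma policy_Psi: "\<mu>\<^sub>0 \<le> x \<Longrightarrow> \<mu> (\<Psi> x / r) = x"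
  using rate_pos unfolding optimal_policy_def policy_domain
  by (simp add: the_inv_into_f_f[OF inj_on_Psi])

lemma surj_Psi:
  assumes "0 \<le> s"
  shows "\<exists>x\<ge>\<mu>\<^sub>0. \<Psi> x = s"
proof -
  \<comment> \<open>by the linear lower bound \<open>\<Psi>\<close> has reached \<open>s\<close> at this point\<close>
  define b where "b = \<mu>\<^sub>0 + s * \<phi> \<mu>\<^sub>0"
  have b: "\<mu>\<^sub>0 \<le> b" using assms tail_integral_pos[of "\<mu>\<^sub>0"] by (simp add: b_def)
  have "s \<le> \<Psi> b"
    using Psi_increase[OF order.refl b] tail_integral_pos[of "\<mu>\<^sub>0"]
    by (simp add: Psi_lower b_def)
  moreover have "continuous_on {\<mu>\<^sub>0..b} \<Psi>"
    unfolding Psi_eq_integral[abs_def]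
    by (intro indefinite_integral_continuous_1 integrable_continuous_real continuous_on_inverse_tail)
  ultimately have "\<exists>x\<ge>\<mu>\<^sub>0. x \<le> b \<and> \<Psi> x = s"
    using assms b by (intro IVT') (auto simp: Psi_lower)
  thus ?thesis by blast
qed

lemma
  assumes "0 \<le> t"
  shows policy_ge: "\<mu>\<^sub>0 \<le> \<mu> t" and Psi_policy: "\<Psi> (\<mu> t) = r * t"
proof -
  obtain x where x: "x \<ge> \<mu>\<^sub>0" "\<Psi> x = r * t"
    using surj_Psi[of "r * t"] assms rate_pos by auto
  with policy_Psi[OF x(1)] rate_pos have "\<mu> t = x" by simp
  with x show "\<mu>\<^sub>0 \<le> \<mu> t" "\<Psi> (\<mu> t) = r * t" by auto
qed

lemma policy_0: "\<mu> 0 = \<mu>\<^sub>0"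
  using policy_Psi[of "\<mu>\<^sub>0"] by (simp add: Psi_lower)

lemma policy_strict_mono: "0 \<le> s \<Longrightarrow> s < t \<Longrightarrow> \<mu> s < \<mu> t"
  using Psi_strict_mono[of "\<mu> t" "\<mu> s"] policy_ge[of s] policy_ge[of t] Psi_policy[of s]
    Psi_policy[of t] rate_pos
  by (smt (verit) mult_strict_left_mono)

lemma policy_mono: "0 \<le> s \<Longrightarrow> s \<le> t \<Longrightarrow> \<mu> s \<le> \<mu> t"
  using policy_strict_mono[of s t] by (cases "s = t") auto

lemma policy_lipschitz:
  assumes "0 \<le> s" "s \<le> t"
  shows "\<mu> t - \<mu> s \<le> r * \<phi> \<mu>\<^sub>0 * (t - s)"
  using Psi_increase[of "\<mu> s" "\<mu> t"] policy_mono[OF assms] policy_ge Psi_policy assms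
    tail_integral_pos[of "\<mu>\<^sub>0"]
  by (simp add: field_simps)

lemma continuous_on_policy: "continuous_on {0..} \<mu>"
proof -
  have "(r * \<phi> \<mu>\<^sub>0)-lipschitz_on {0..} \<mu>"
  proof (rule lipschitz_onI)
    fix s t :: real assume "s \<in> {0..}" "t \<in> {0..}"
    thus "dist (\<mu> s) (\<mu> t) \<le> r * \<phi> \<mu>\<^sub>0 * dist s t"
      using policy_lipschitz[of s t] policy_lipschitz[of t s] policy_mono[of s t] policy_mono[of t s]
      by (cases "s \<le> t") (auto simp: dist_real_def)
  qed (use rate_pos tail_integral_pos[of "\<mu>\<^sub>0"] in auto)
  thus ?thesis by (rule lipschitz_on_continuous_on)
qed

lemma isCont_policy: "0 < t \<Longrightarrow> isCont \<mu> t"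
  using continuous_on_policy by (intro continuous_on_interior[of "{0..}"]) auto

lemma policy_deriv:
  assumes "0 < t"
  shows "(\<mu> has_real_derivative r * \<phi> (\<mu> t)) (at t)"
proof -
  have "\<mu>\<^sub>0 < \<mu> t" using policy_strict_mono[of 0 t] assms by (simp add: policy_0)
  hence "((\<lambda>x. \<Psi> x / r) has_real_derivative 1 / \<phi> (\<mu> t) / r) (at (\<mu> t))"
    by (intro DERIV_cdivide Psi_deriv)
  hence "(\<mu> has_real_derivative inverse (1 / \<phi> (\<mu> t) / r)) (at t)"
    by (rule DERIV_inverse_function[where a = 0 and b = "t + 1"])
      (use assms rate_pos tail_integral_pos[of "\<mu> t"] Psi_policy in
        \<open>auto intro: isCont_policy\<close>)
  thus ?thesis by (simp add: field_simps)
qed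

lemma policy_at_top: "filterlim \<mu> at_top at_top"
  unfolding filterlim_at_top
proof
  fix Z
  define z where "z = max Z \<mu>\<^sub>0"
  have z: "\<mu> (\<Psi> z / r) = z" by (rule policy_Psi) (simp add: z_def)
  have "0 \<le> (z - \<mu>\<^sub>0) / \<phi> \<mu>\<^sub>0"
    using tail_integral_pos[of "\<mu>\<^sub>0"] by (simp add: z_def)
  also have "\<dots> \<le> \<Psi> z"
    using Psi_increase[of "\<mu>\<^sub>0" z] by (simp add: Psi_lower z_def)
  finally have "\<Psi> z \<ge> 0" .
  hence "\<forall>t\<ge>\<Psi> z / r. Z \<le> \<mu> t"
    using policy_mono[of "\<Psi> z / r"] rate_pos unfolding z
    by (metis divide_nonneg_pos max.bounded_iff z_def)
  thus "\<forall>\<^sub>F t in at_top. Z \<le> \<mu> t"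
    unfolding eventually_at_top_linorder by blast
qed

end

section \<open>The search as a Markov chain\<close>

text \<open>The state of the search is a single real number: the remaining time, or \<open>-1\<close> once an offer has been
accepted. The search thereby becomes a Markov chain driven by independent pairs of an inter-arrival
time and an offer. The remaining time \<open>0\<close> and the state \<open>-1\<close> are absorbing for nonnegative
inter-arrival times.\<close>

definition search_step :: "(real \<Rightarrow> real) \<Rightarrow> real \<Rightarrow> real \<Rightarrow> real \<Rightarrow> real" where
  "search_step m r d x =
     (if r < 0 then r else if 0 < r - d \<and> m (r - d) \<le> x then -1 else max (r - d) 0)"

fun search_state ::
  "(real \<Rightarrow> real) \<Rightarrow> (nat \<Rightarrow> real) \<Rightarrow> (nat \<Rightarrow> real) \<Rightarrow> real \<Rightarrow> nat \<Rightarrow> real" where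
  "search_state m d x t 0 = t"
| "search_state m d x t (Suc n) = search_step m (search_state m d x t n) (d (Suc n)) (x (Suc n))"

text \<open>The reward for the price is paid in the step in which the offer is accepted. At most one step of a
path has a nonzero gain, so a sum of gains is the reward of the price.\<close>

definition gain ::
  "(real \<Rightarrow> real) \<Rightarrow> (real \<Rightarrow> real) \<Rightarrow> real \<Rightarrow> real \<Rightarrow> real \<Rightarrow> ennreal" where
  "gain m h r d x = (if 0 \<le> r \<and> 0 < r - d \<and> m (r - d) \<le> x then ennreal (h x) else 0)"

text \<open>Policies are consulted at positive times only. This permits replacing a policy on \<open>[0, \<infinity>)\<close> by a
monotone function on the whole line.\<close>

lemma sale_price_cong:
  assumes "\<And>s. 0 < s \<Longrightarrow> m s = m' s"
  shows "sale_price m d x t = sale_price m' d x t"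
proof -
  have "acceptable m d x t = acceptable m' d x t"
    by (auto simp: acceptable_def assms fun_eq_iff)
  thus ?thesis by (simp add: sale_price_def)
qed

lemma time_left_nonneg: "0 \<le> t \<Longrightarrow> 0 \<le> time_left d t n"
  by (induction n) auto

lemma search_state_eq:
  assumes "0 \<le> t"
  shows "search_state m d x t n =
    (if \<exists>i\<le>n. acceptable m d x t i then -1 else time_left d t n)"
proof (induction n)
  case 0
  show ?case by (auto simp: acceptable_def)
next
  case (Suc n)
  show ?case
  proof (cases "\<exists>i\<le>n. acceptable m d x t i")
    case True
    moreover from True have "\<exists>i\<le>Suc n. acceptable m d x t i" by (meson le_Suc_eq)
    ultimately show ?thesis using Suc.IH by (simp add: search_step_def)
  next
    case False
    hence "(\<exists>i\<le>Suc n. acceptable m d x t i) \<longleftrightarrow> acceptable m d x t (Suc n)"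
      by (auto simp: le_Suc_eq)
    moreover have "acceptable m d x t (Suc n) \<longleftrightarrow>
      0 < time_left d t n - d (Suc n) \<and> m (time_left d t n - d (Suc n)) \<le> x (Suc n)"
      by (auto simp: acceptable_def max_def)
    ultimately show ?thesis
      using Suc.IH False time_left_nonneg[OF assms, of d n] by (auto simp: search_step_def)
  qed
qed

lemma gain_search_state:
  assumes "0 \<le> t"
  shows "gain m h (search_state m d x t n) (d (Suc n)) (x (Suc n)) =
    (if acceptable m d x t (Suc n) \<and> \<not> (\<exists>i\<le>n. acceptable m d x t i)
     then ennreal (h (x (Suc n))) else 0)"
  using time_left_nonneg[OF assms, of d n]
  by (auto simp: gain_def search_state_eq[OF assms] acceptable_def max_def)

lemma suminf_gain:
  assumes "0 \<le> t"
  shows "(\<Sum>n. gain m h (search_state m d x t n) (d (Suc n)) (x (Suc n))) =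
    (if \<exists>i. acceptable m d x t i then ennreal (h (x (LEAST i. acceptable m d x t i))) else 0)"
proof (cases "\<exists>i. acceptable m d x t i")
  case True
  define k where "k = (LEAST i. acceptable m d x t i)"
  have k: "acceptable m d x t k" unfolding k_def using True by (rule LeastI_ex)
  have min: "\<not> acceptable m d x t i" if "i < k" for i
    using that unfolding k_def by (rule not_less_Least)
  from k obtain j where j: "k = Suc j" by (cases k) (auto simp: acceptable_def)
  have iff: "acceptable m d x t (Suc n) \<and> \<not> (\<exists>i\<le>n. acceptable m d x t i) \<longleftrightarrow> n = j" for n
  proof
    assume n: "acceptable m d x t (Suc n) \<and> \<not> (\<exists>i\<le>n. acceptable m d x t i)"
    hence "\<not> Suc n < k" "\<not> k \<le> n" using min k by auto
    thus "n = j" using j by simp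
  qed (use min k j in auto)
  have "(\<Sum>n. gain m h (search_state m d x t n) (d (Suc n)) (x (Suc n))) =
        (\<Sum>n. if n = j then ennreal (h (x k)) else 0)"
    unfolding gain_search_state[OF assms] iff by (intro suminf_cong) (auto simp: j)
  also have "\<dots> = ennreal (h (x k))"
    by (subst suminf_finite[of "{j}"]) auto
  finally show ?thesis using True by (simp add: k_def)
next
  case False
  thus ?thesis by (simp add: gain_search_state[OF assms])
qed

lemma search_state_cong:
  assumes "\<And>i. 1 \<le> i \<Longrightarrow> i \<le> n \<Longrightarrow> d i = d' i" "\<And>i. 1 \<le> i \<Longrightarrow> i \<le> n \<Longrightarrow> x i = x' i"
  shows "search_state m d x t n = search_state m d' x' t n"
  using assms by (induction n) auto

lemma measurable_search_step [measurable]: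
  assumes [measurable]: "m \<in> borel_measurable borel"
    "f \<in> borel_measurable M" "g \<in> borel_measurable M" "k \<in> borel_measurable M"
  shows "(\<lambda>w. search_step m (f w) (g w) (k w)) \<in> borel_measurable M"
  unfolding search_step_def by measurable

lemma measurable_gain [measurable]:
  assumes [measurable]: "m \<in> borel_measurable borel" "h \<in> borel_measurable borel"
    "f \<in> borel_measurable M" "g \<in> borel_measurable M" "k \<in> borel_measurable M"
  shows "(\<lambda>w. gain m h (f w) (g w) (k w)) \<in> borel_measurable M"
  unfolding gain_def by measurable

lemma measurable_search_state:
  assumes [measurable]: "m \<in> borel_measurable borel"
    and "\<And>i. 1 \<le> i \<Longrightarrow> i \<le> n \<Longrightarrow> (\<lambda>w. d w i) \<in> borel_measurable M"
    and "\<And>i. 1 \<le> i \<Longrightarrow> i \<le> n \<Longrightarrow> (\<lambda>w. x w i) \<in> borel_measurable M"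
  shows "(\<lambda>w. search_state m (d w) (x w) t n) \<in> borel_measurable M"
  using assms(2,3) by (induction n) (auto intro!: measurable_search_step)

locale threshold_search = prob_space P for P :: "'a measure" +
  fixes D X :: "nat \<Rightarrow> 'a \<Rightarrow> real" and N :: "real measure" and lam :: real
    and m :: "real \<Rightarrow> real"
  assumes lam_pos: "0 < lam"
    and indep: "indep_vars (\<lambda>_. borel) (case_sum D X) ({1..} <+> {0..})"
    and arrivals: "\<And>i. 1 \<le> i \<Longrightarrow> distributed P lborel (D i) (exponential_density lam)"
    and offers: "\<And>i. 1 \<le> i \<Longrightarrow> distr P borel (X i) = N"
    and threshold_mono: "mono m"
begin

lemma measurable_D: "1 \<le> i \<Longrightarrow> D i \<in> borel_measurable P"
  using indep unfolding indep_vars_def by (auto dest: bspec[of _ _ "Inl i"])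

lemma measurable_X: "X i \<in> borel_measurable P"
  using indep unfolding indep_vars_def by (auto dest: bspec[of _ _ "Inr i"])

lemma measurable_threshold [measurable]: "m \<in> borel_measurable borel"
  by (rule borel_measurable_mono[OF threshold_mono])

sublocale offer: prob_space N
  using prob_space_distr[OF measurable_X[of 1]] offers[of 1] by simp

lemma sets_offer [simp, measurable_cong]: "sets N = sets borel"
  using offers[of 1] by (metis order.refl sets_distr)

abbreviation state :: "real \<Rightarrow> nat \<Rightarrow> 'a \<Rightarrow> real" where
  "state t n \<omega> \<equiv> search_state m (\<lambda>i. D i \<omega>) (\<lambda>i. X i \<omega>) t n"

lemma measurable_state [measurable]: "state t n \<in> borel_measurable P"
  by (intro measurable_search_state measurable_threshold measurable_D measurable_X)

text \<open>The predicate \<open>indep_var\<close> wants random variables of the same type, so the state is padded to a pair.\<close>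

lemma indep_state_next:
  "indep_var (borel \<Otimes>\<^sub>M borel) (\<lambda>\<omega>. (state t n \<omega>, 0 :: real))
             (borel \<Otimes>\<^sub>M borel) (\<lambda>\<omega>. (D (Suc n) \<omega>, X (Suc n) \<omega>))"
proof -
  define A where "A = ({1..n} <+> {1..n} :: (nat + nat) set)"
  define B where "B = ({Inl (Suc n), Inr (Suc n)} :: (nat + nat) set)"
  define Y1 where "Y1 = (\<lambda>z. (search_state m (\<lambda>i. z (Inl i)) (\<lambda>i. z (Inr i)) t n, 0 :: real))"
  define Y2 where "Y2 = (\<lambda>z :: nat + nat \<Rightarrow> real. (z (Inl (Suc n)), z (Inr (Suc n))))"
  have "indep_var (PiM A (\<lambda>_. borel)) (\<lambda>\<omega>. \<lambda>i\<in>A. case_sum D X i \<omega>)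
                  (PiM B (\<lambda>_. borel)) (\<lambda>\<omega>. \<lambda>i\<in>B. case_sum D X i \<omega>)"
    by (rule indep_var_restrict[OF indep]) (auto simp: A_def B_def)
  moreover have "Y1 \<in> PiM A (\<lambda>_. borel) \<rightarrow>\<^sub>M borel \<Otimes>\<^sub>M borel"
    unfolding Y1_def
    by (intro measurable_Pair measurable_const measurable_search_state measurable_threshold)
      (auto simp: A_def intro!: measurable_component_singleton)
  moreover have "Y2 \<in> PiM B (\<lambda>_. borel) \<rightarrow>\<^sub>M borel \<Otimes>\<^sub>M borel"
    unfolding Y2_def by (intro measurable_Pair measurable_component_singleton) (auto simp: B_def)
  ultimately have "indep_var (borel \<Otimes>\<^sub>M borel) (Y1 \<circ> (\<lambda>\<omega>. \<lambda>i\<in>A. case_sum D X i \<omega>))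
    (borel \<Otimes>\<^sub>M borel) (Y2 \<circ> (\<lambda>\<omega>. \<lambda>i\<in>B. case_sum D X i \<omega>))"
    by (rule indep_var_compose)
  moreover have "Y1 \<circ> (\<lambda>\<omega>. \<lambda>i\<in>A. case_sum D X i \<omega>) = (\<lambda>\<omega>. (state t n \<omega>, 0))"
    unfolding Y1_def o_def prod.inject fun_eq_iff
    by (intro allI conjI search_state_cong refl) (auto simp: A_def)
  moreover have "Y2 \<circ> (\<lambda>\<omega>. \<lambda>i\<in>B. case_sum D X i \<omega>) = (\<lambda>\<omega>. (D (Suc n) \<omega>, X (Suc n) \<omega>))"
    by (auto simp: Y2_def B_def)
  ultimately show ?thesis by simp
qed

lemma indep_arrival_offer: "1 \<le> i \<Longrightarrow> indep_var borel (D i) borel (X i)"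
  using indep_var_compose[OF indep_var_restrict[OF indep, of "{Inl i}" "{Inr i}"],
      of "\<lambda>z. z (Inl i)" borel "\<lambda>z. z (Inr i)" borel]
  by (auto simp: o_def intro!: measurable_component_singleton)

lemma distr_arrival:
  assumes "1 \<le> i"
  shows "distr P borel (D i) = density lborel (\<lambda>x. ennreal (exponential_density lam x))"
proof -
  have "distr P borel (D i) = distr P lborel (D i)" by (rule distr_cong) auto
  also have "\<dots> = density lborel (\<lambda>x. ennreal (exponential_density lam x))"
    by (rule distributed_distr_eq_density[OF arrivals[OF assms]])
  finally show ?thesis .
qed

abbreviation arrival_law :: "real measure" where
  "arrival_law \<equiv> density lborel (\<lambda>x. ennreal (exponential_density lam x))"

sublocale arrival: prob_space arrival_law
  using prob_space_distr[OF measurable_D[of 1]] distr_arrival[of 1] by simp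

text \<open>The next inter-arrival time and offer are independent of the current state and of each other, so they
can be integrated out for a fixed state.\<close>

lemma nn_integral_next:
  assumes f [measurable]: "(\<lambda>(r, d, x). f r d x) \<in> borel_measurable (borel \<Otimes>\<^sub>M borel \<Otimes>\<^sub>M borel)"
  shows "(\<integral>\<^sup>+\<omega>. f (state t n \<omega>) (D (Suc n) \<omega>) (X (Suc n) \<omega>) \<partial>P) =
    (\<integral>\<^sup>+\<omega>. (\<integral>\<^sup>+d. (\<integral>\<^sup>+x. f (state t n \<omega>) d x \<partial>N) \<partial>arrival_law) \<partial>P)"
proof -
  have [measurable]: "D (Suc n) \<in> borel_measurable P" "X (Suc n) \<in> borel_measurable P"
    by (auto intro: measurable_D measurable_X)
  interpret EN: pair_prob_space arrival_law N ..
  define Q where "Q = distr P (borel \<Otimes>\<^sub>M borel) (\<lambda>\<omega>. (state t n \<omega>, 0 :: real))"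
  have [measurable_cong, simp]: "sets Q = sets (borel \<Otimes>\<^sub>M borel)" by (simp add: Q_def)
  define g where "g = (\<lambda>p :: (real \<times> real) \<times> (real \<times> real). f (fst (fst p)) (fst (snd p)) (snd (snd p)))"
  have g [measurable]: "g \<in> borel_measurable ((borel \<Otimes>\<^sub>M borel) \<Otimes>\<^sub>M (borel \<Otimes>\<^sub>M borel))"
    unfolding g_def
    using measurable_compose[OF _ f, of "\<lambda>p. (fst (fst p), fst (snd p), snd (snd p))"
        "(borel \<Otimes>\<^sub>M borel) \<Otimes>\<^sub>M (borel \<Otimes>\<^sub>M borel)"]
    by (simp add: case_prod_beta)
  have pair: "distr P (borel \<Otimes>\<^sub>M borel) (\<lambda>\<omega>. (D (Suc n) \<omega>, X (Suc n) \<omega>)) = arrival_law \<Otimes>\<^sub>M N"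
    using indep_arrival_offer[of "Suc n"] distr_arrival[of "Suc n"] offers[of "Suc n"]
    unfolding indep_var_distribution_eq by simp
  have joint: "distr P ((borel \<Otimes>\<^sub>M borel) \<Otimes>\<^sub>M (borel \<Otimes>\<^sub>M borel))
      (\<lambda>\<omega>. ((state t n \<omega>, 0), D (Suc n) \<omega>, X (Suc n) \<omega>)) = Q \<Otimes>\<^sub>M (arrival_law \<Otimes>\<^sub>M N)"
    using indep_state_next[of t n] unfolding indep_var_distribution_eq pair Q_def by simp
  have "(\<integral>\<^sup>+\<omega>. f (state t n \<omega>) (D (Suc n) \<omega>) (X (Suc n) \<omega>) \<partial>P) =
    (\<integral>\<^sup>+z. g z \<partial>(Q \<Otimes>\<^sub>M (arrival_law \<Otimes>\<^sub>M N)))"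
    unfolding joint[symmetric] by (subst nn_integral_distr) (measurable, simp add: g_def)
  also have "\<dots> = (\<integral>\<^sup>+p. (\<integral>\<^sup>+z. g (p, z) \<partial>(arrival_law \<Otimes>\<^sub>M N)) \<partial>Q)"
    by (rule EN.nn_integral_fst[symmetric]) measurable
  also have "\<dots> = (\<integral>\<^sup>+\<omega>. (\<integral>\<^sup>+z. g ((state t n \<omega>, 0), z) \<partial>(arrival_law \<Otimes>\<^sub>M N)) \<partial>P)"
    unfolding Q_def by (rule nn_integral_distr) measurable
  also have "\<dots> = (\<integral>\<^sup>+\<omega>. (\<integral>\<^sup>+d. (\<integral>\<^sup>+x. f (state t n \<omega>) d x \<partial>N) \<partial>arrival_law) \<partial>P)"
  proof (rule nn_integral_cong)
    fix \<omega>
    have "(\<integral>\<^sup>+d. (\<integral>\<^sup>+x. g ((state t n \<omega>, 0), (d, x)) \<partial>N) \<partial>arrival_law) =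
        (\<integral>\<^sup>+z. g ((state t n \<omega>, 0), z) \<partial>(arrival_law \<Otimes>\<^sub>M N))"
      by (rule offer.nn_integral_fst) measurable
    thus "(\<integral>\<^sup>+z. g ((state t n \<omega>, 0), z) \<partial>(arrival_law \<Otimes>\<^sub>M N)) =
        (\<integral>\<^sup>+d. (\<integral>\<^sup>+x. f (state t n \<omega>) d x \<partial>N) \<partial>arrival_law)"
      by (simp add: g_def)
  qed
  finally show ?thesis .
qed

lemma AE_arrival_nonneg: "AE \<omega> in P. \<forall>i\<ge>1. 0 \<le> D i \<omega>"
  unfolding AE_all_countable
proof
  fix i :: nat
  show "AE \<omega> in P. 1 \<le> i \<longrightarrow> 0 \<le> D i \<omega>"
  proof (cases "1 \<le> i")
    case True
    have "AE x in arrival_law. 0 \<le> x"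
      by (subst AE_density) (auto simp: exponential_density_def)
    hence "AE \<omega> in P. 0 \<le> D i \<omega>"
      unfolding distr_arrival[OF True, symmetric]
      by (subst (asm) AE_distr_iff) (auto intro: measurable_D[OF True])
    thus ?thesis by simp
  qed simp
qed

lemma nn_integral_exp_arrival:
  assumes "1 \<le> i"
  shows "(\<integral>\<^sup>+\<omega>. ennreal (exp (- D i \<omega>)) \<partial>P) = ennreal (lam / (lam + 1))"
proof -
  have "(\<integral>\<^sup>+\<omega>. ennreal (exp (- D i \<omega>)) \<partial>P) = (\<integral>\<^sup>+x. ennreal (exp (- x)) \<partial>arrival_law)"
    unfolding distr_arrival[OF assms, symmetric]
    by (subst nn_integral_distr[OF measurable_D[OF assms]]) auto
  also have "\<dots> = (\<integral>\<^sup>+x. ennreal (exponential_density lam x) * ennreal (exp (- x)) \<partial>lborel)"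
    by (rule nn_integral_density) auto
  also have "\<dots> = (\<integral>\<^sup>+x. ennreal (lam * exp (- (lam + 1) * x)) * indicator {0..} x \<partial>lborel)"
    using lam_pos by (intro nn_integral_cong)
      (auto simp: exponential_density_def indicator_def ennreal_mult'[symmetric] algebra_simps
        simp flip: exp_add)
  also have "\<dots> = ennreal (0 - (- (lam / (lam + 1)) * exp (- (lam + 1) * 0)))"
  proof (rule nn_integral_FTC_atLeast)
    show "((\<lambda>x. - (lam / (lam + 1)) * exp (- (lam + 1) * x)) has_real_derivative
        lam * exp (- (lam + 1) * x)) (at x)" for x
      using lam_pos by (auto intro!: derivative_eq_intros simp: divide_simps) (simp add: algebra_simps)
    have "filterlim (\<lambda>x. - (lam + 1) * x) at_bot at_top"
      using lam_pos by (intro filterlim_tendsto_neg_mult_at_bot[OF tendsto_const]) (auto simp: filterlim_ident)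
    hence "((\<lambda>x. exp (- (lam + 1) * x)) \<longlongrightarrow> 0) at_top"
      by (rule filterlim_compose[OF exp_at_bot])
    thus "((\<lambda>x. - (lam / (lam + 1)) * exp (- (lam + 1) * x)) \<longlongrightarrow> 0) at_top"
      by (rule tendsto_mult_right_zero)
  qed (use lam_pos in auto)
  finally show ?thesis by simp
qed

text \<open>As long as time remains after \<open>n\<close> offers, the first \<open>n\<close> inter-arrival times add up to less than \<open>t\<close>.
By Markov's inequality for \<open>exp (- (D\<^sub>1 + \<dots> + D\<^sub>n))\<close> this has a probability of at most
\<open>exp t \<cdot> (lam / (lam + 1))\<^sup>n\<close>.\<close>

lemma AE_deadline_reached: "AE \<omega> in P. \<exists>n. time_left (\<lambda>i. D i \<omega>) t n \<le> 0"
proof -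
  let ?T = "\<lambda>\<omega> n. time_left (\<lambda>i. D i \<omega>) t n"
  have [measurable]: "(\<lambda>\<omega>. ?T \<omega> n) \<in> borel_measurable P" for n
    by (induction n) (auto intro!: measurable_D borel_measurable_max borel_measurable_diff)
  define q where "q = lam / (lam + 1)"
  have q: "0 \<le> q" "q < 1" using lam_pos by (auto simp: q_def)
  define Z where "Z = {\<omega> \<in> space P. \<forall>n. 0 < ?T \<omega> n}"
  have [measurable]: "Z \<in> sets P" unfolding Z_def by measurable
  have bound: "emeasure P Z \<le> ennreal (exp t * q ^ n)" for n
  proof -
    have ind: "indep_vars (\<lambda>_. borel) (case_sum D X) (Inl ` {1..n})"
      by (rule indep_vars_subset[OF indep]) auto
    have "emeasure P Z = (\<integral>\<^sup>+\<omega>. indicator Z \<omega> \<partial>P)" by simp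
    also have "\<dots> \<le> (\<integral>\<^sup>+\<omega>. ennreal (exp t) *
        (\<Prod>i\<in>Inl ` {1..n}. ennreal (exp (- case_sum D X i \<omega>))) \<partial>P)"
    proof (rule nn_integral_mono)
      fix \<omega> assume "\<omega> \<in> space P"
      show "indicator Z \<omega> \<le> ennreal (exp t) *
        (\<Prod>i\<in>Inl ` {1..n}. ennreal (exp (- case_sum D X i \<omega>)))"
      proof (cases "\<omega> \<in> Z")
        case True
        have "?T \<omega> n = t - (\<Sum>i=1..n. D i \<omega>)" for n
        proof (induction n)
          case (Suc n)
          have "0 < ?T \<omega> (Suc n)" using True unfolding Z_def by blast
          with Suc.IH show ?case by (simp add: max_def split: if_splits)
        qed simp
        moreover have "0 < ?T \<omega> n" using True unfolding Z_def by blast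
        ultimately have "(\<Sum>i=1..n. D i \<omega>) < t" by simp
        hence "1 \<le> exp (t - (\<Sum>i=1..n. D i \<omega>))" by simp
        also have "\<dots> = exp t * (\<Prod>i=1..n. exp (- D i \<omega>))"
          by (simp add: exp_sum[symmetric] sum_negf exp_add[symmetric])
        finally have "1 \<le> exp t * (\<Prod>i=1..n. exp (- D i \<omega>))" .
        thus ?thesis using True
          by (simp add: prod.reindex prod_ennreal ennreal_mult'[symmetric] prod_nonneg
              ennreal_1[symmetric] del: ennreal_1)
      qed simp
    qed
    also have "\<dots> = ennreal (exp t) *
        (\<integral>\<^sup>+\<omega>. (\<Prod>i\<in>Inl ` {1..n}. ennreal (exp (- case_sum D X i \<omega>))) \<partial>P)"
    proof (rule nn_integral_cmult)
      have "(\<lambda>\<omega>. ennreal (exp (- case_sum D X i \<omega>))) \<in> borel_measurable P"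
        if i: "i \<in> Inl ` {1..n}" for i :: "nat + nat"
      proof -
        from i obtain j where "i = Inl j" "1 \<le> j" by auto
        thus ?thesis using measurable_D[of j] by simp
      qed
      thus "(\<lambda>\<omega>. \<Prod>i\<in>Inl ` {1..n}. ennreal (exp (- case_sum D X i \<omega>))) \<in> borel_measurable P"
        by (intro borel_measurable_prod_ennreal)
    qed
    also have "(\<integral>\<^sup>+\<omega>. (\<Prod>i\<in>Inl ` {1..n}. ennreal (exp (- case_sum D X i \<omega>))) \<partial>P) =
        (\<Prod>i\<in>Inl ` {1..n}. \<integral>\<^sup>+\<omega>. ennreal (exp (- case_sum D X i \<omega>)) \<partial>P)"
      by (intro indep_vars_nn_integral indep_vars_compose2[OF ind]) auto
    also have "\<dots> = ennreal q ^ n"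
      by (simp add: prod.reindex nn_integral_exp_arrival q_def)
    finally show ?thesis
      using q by (simp add: ennreal_mult' ennreal_power)
  qed
  have "emeasure P Z \<le> 0"
  proof (rule LIMSEQ_le_const)
    have "(\<lambda>n. ennreal (exp t * q ^ n)) \<longlonglongrightarrow> ennreal (exp t * 0)"
      using q by (intro tendsto_ennrealI tendsto_mult_left LIMSEQ_power_zero) auto
    thus "(\<lambda>n. ennreal (exp t * q ^ n)) \<longlonglongrightarrow> 0" by simp
  qed (use bound in auto)
  hence "Z \<in> null_sets P" by (auto simp: null_sets_def)
  thus ?thesis
    by (rule AE_I') (auto simp: Z_def not_le)
qed

end

section \<open>Verification of expected rewards\<close>

text \<open>The differential equation says that at rate \<open>lam\<close> the value \<open>V s\<close> is exchanged for the reward of an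
acceptable offer. The exceptional set \<open>C\<close> accommodates atoms of the offer distribution.\<close>

locale search_value = threshold_search P D X N lam m
  for P :: "'a measure" and D X N lam m +
  fixes h V :: "real \<Rightarrow> real" and C :: "real set"
  assumes measurable_reward [measurable]: "h \<in> borel_measurable borel"
    and reward_nonneg: "\<And>x. m 0 \<le> x \<Longrightarrow> 0 \<le> h x"
    and reward_integrable: "integrable N (\<lambda>x. if m 0 \<le> x then h x else 0)"
    and V_cont: "continuous_on UNIV V"
    and V_nonneg: "\<And>s. 0 \<le> V s"
    and countable_exceptions: "countable C"
    and V_deriv: "\<And>s. 0 < s \<Longrightarrow> s \<notin> C \<Longrightarrow> (V has_real_derivative
          lam * (\<integral>x. (if m s \<le> x then h x - V s else 0) \<partial>N)) (at s)"
    and drift_cont: "\<And>s. 0 < s \<Longrightarrow> s \<notin> C \<Longrightarrow>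
          isCont (\<lambda>s. \<integral>x. (if m s \<le> x then h x - V s else 0) \<partial>N) s"
begin

text \<open>The value at the instant at which an offer arrives with remaining time \<open>s\<close>, before it is inspected:
the mean of \<open>h\<close> on acceptable offers and of \<open>V s\<close> on the others.\<close>

definition offer_value :: "real \<Rightarrow> real" where
  "offer_value s = V s + (\<integral>x. (if m s \<le> x then h x - V s else 0) \<partial>N)"

lemma measurable_V [measurable]: "V \<in> borel_measurable borel"
  by (rule borel_measurable_continuous_onI[OF V_cont])

lemma measurable_offer_value [measurable]: "offer_value \<in> borel_measurable borel"
  unfolding offer_value_def by measurable

lemma accepted_reward_nonneg: "0 \<le> s \<Longrightarrow> m s \<le> x \<Longrightarrow> 0 \<le> h x"
  using monoD[OF threshold_mono, of 0 s] by (intro reward_nonneg) auto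

lemma accepted_reward_integrable:
  assumes "0 \<le> s"
  shows "integrable N (\<lambda>x. if m s \<le> x then h x else 0)"
  by (rule Bochner_Integration.integrable_bound[OF reward_integrable])
    (use monoD[OF threshold_mono assms] in auto)

lemma
  assumes "0 \<le> s"
  shows offer_value_eq: "offer_value s = (\<integral>x. (if m s \<le> x then h x else V s) \<partial>N)"
    and offer_value_integrable: "integrable N (\<lambda>x. if m s \<le> x then h x else V s)"
proof -
  have int: "integrable N (\<lambda>x. if m s \<le> x then V s else 0)"
    by (rule offer.integrable_const_bound[where B = "\<bar>V s\<bar>"]) auto
  have int': "integrable N (\<lambda>x. if m s \<le> x then h x - V s else 0)"
    using Bochner_Integration.integrable_diff[OF accepted_reward_integrable[OF assms] int]
    by (rule back_subst[of "integrable N"]) auto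
  have eq: "(\<lambda>x. V s + (if m s \<le> x then h x - V s else 0)) = (\<lambda>x. if m s \<le> x then h x else V s)"
    by auto
  show "integrable N (\<lambda>x. if m s \<le> x then h x else V s)"
    using Bochner_Integration.integrable_add[OF offer.integrable_const[of "V s"] int'] unfolding eq .
  show "offer_value s = (\<integral>x. (if m s \<le> x then h x else V s) \<partial>N)"
    unfolding offer_value_def eq[symmetric]
    using offer.prob_space by (subst Bochner_Integration.integral_add) (auto intro: int')
qed

lemma offer_value_nonneg: "0 \<le> s \<Longrightarrow> 0 \<le> offer_value s"
  using accepted_reward_nonneg V_nonneg
  by (auto simp: offer_value_eq intro!: Bochner_Integration.integral_nonneg)

lemma offer_value_upper:
  assumes "0 \<le> s"
  shows "offer_value s \<le> (\<integral>x. (if m 0 \<le> x then h x else 0) \<partial>N) + V s"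
proof -
  have "offer_value s \<le> (\<integral>x. (if m 0 \<le> x then h x else 0) + V s \<partial>N)"
    unfolding offer_value_eq[OF assms]
    by (intro integral_mono offer_value_integrable assms Bochner_Integration.integrable_add
        reward_integrable offer.integrable_const)
      (use monoD[OF threshold_mono assms] V_nonneg[of s] reward_nonneg in auto)
  also have "\<dots> = (\<integral>x. (if m 0 \<le> x then h x else 0) \<partial>N) + V s"
    using offer.prob_space by (subst Bochner_Integration.integral_add) (auto intro: reward_integrable)
  finally show ?thesis .
qed

lemma nn_integral_offer_value:
  assumes "0 \<le> s"
  shows "(\<integral>\<^sup>+x. (if m s \<le> x then ennreal (h x) else ennreal (V s)) \<partial>N) = ennreal (offer_value s)"
proof -
  have "(\<integral>\<^sup>+x. (if m s \<le> x then ennreal (h x) else ennreal (V s)) \<partial>N) =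
        (\<integral>\<^sup>+x. ennreal (if m s \<le> x then h x else V s) \<partial>N)"
    by (intro nn_integral_cong) auto
  also have "\<dots> = ennreal (offer_value s)"
    unfolding offer_value_eq[OF assms] using accepted_reward_nonneg[OF assms] V_nonneg
    by (intro nn_integral_eq_integral offer_value_integrable assms) auto
  finally show ?thesis .
qed

lemma V_bounded:
  obtains B where "0 \<le> B" "\<And>s. 0 \<le> s \<Longrightarrow> s \<le> r \<Longrightarrow> V s \<le> B"
proof (cases "0 \<le> r")
  case True
  have "\<exists>x\<in>{0..r}. \<forall>y\<in>{0..r}. V y \<le> V x"
    using True by (intro continuous_attains_sup continuous_on_subset[OF V_cont]) auto
  then obtain x where "x \<in> {0..r}" "\<And>y. y \<in> {0..r} \<Longrightarrow> V y \<le> V x" by blast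
  thus ?thesis using V_nonneg[of x] by (intro that[of "V x"]) auto
next
  case False
  thus ?thesis by (intro that[of 0]) auto
qed

text \<open>The waiting time \<open>d\<close> for the next offer is exponential. By the differential equation for \<open>V\<close> the
integrand is the derivative of \<open>- exp (- lam * d) * V (r - d)\<close>.\<close>

lemma discounted_integral:
  assumes "0 \<le> r"
  shows "((\<lambda>d. lam * exp (- lam * d) * offer_value (r - d)) has_integral
    (V r - exp (- lam * r) * V 0)) {0..r}"
proof -
  let ?f = "\<lambda>d. lam * exp (- lam * d) * offer_value (r - d)"
  define K where "K = (\<integral>x. (if m 0 \<le> x then h x else 0) \<partial>N)"
  obtain B where B: "0 \<le> B" "\<And>s. 0 \<le> s \<Longrightarrow> s \<le> r \<Longrightarrow> V s \<le> B" using V_bounded[of r] by blast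
  have bound: "\<bar>?f d\<bar> \<le> lam * (K + B)" if "d \<in> {0..r}" for d
  proof -
    have "exp (- lam * d) * offer_value (r - d) \<le> 1 * (K + B)"
      using that lam_pos offer_value_nonneg[of "r - d"] offer_value_upper[of "r - d"] B(2)[of "r - d"]
      unfolding K_def by (intro mult_mono) auto
    thus ?thesis using lam_pos that offer_value_nonneg[of "r - d"] by (simp add: abs_mult mult.assoc)
  qed
  have "integrable lborel (\<lambda>d. indicator {0..r} d *\<^sub>R ?f d)"
  proof (rule Bochner_Integration.integrable_bound)
    show "integrable lborel (\<lambda>d. indicator {0..r} d * (lam * (K + B)))"
      using assms by (intro integrable_mult_left integrable_real_indicator) auto
    show "AE d in lborel. norm (indicator {0..r} d *\<^sub>R ?f d) \<le>
        norm (indicator {0..r} d * (lam * (K + B)))"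
    proof (intro AE_I2)
      fix d :: real
      have "\<bar>?f d\<bar> \<le> \<bar>lam * (K + B)\<bar>" if "d \<in> {0..r}"
        using bound[OF that] by linarith
      thus "norm (indicator {0..r} d *\<^sub>R ?f d) \<le> norm (indicator {0..r} d * (lam * (K + B)))"
        by (simp add: indicator_def)
    qed
  qed measurable
  hence int: "?f integrable_on {0..r}"
    by (intro set_borel_integral_eq_integral) (simp add: set_integrable_def)
  have "(?f has_integral (- exp (- lam * r) * V (r - r) - - exp (- lam * 0) * V (r - 0))) {0..r}"
  proof (rule fundamental_theorem_of_calculus_countable[OF assms _ _ int])
    show "countable ((\<lambda>s. r - s) ` C)" by (intro countable_image countable_exceptions)
    show "continuous_on {0..r} (\<lambda>d. - exp (- lam * d) * V (r - d))"
      by (intro continuous_intros continuous_on_compose2[OF V_cont]) auto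
    fix d assume d: "d \<in> {0<..<r} - (\<lambda>s. r - s) ` C"
    have rd: "0 < r - d" "r - d \<notin> C" using d by (auto simp: image_iff)
    have "((\<lambda>d. V (r - d)) has_real_derivative
        lam * (\<integral>x. (if m (r - d) \<le> x then h x - V (r - d) else 0) \<partial>N) * (0 - 1)) (at d)"
      by (rule DERIV_chain2[where f = V and g = "\<lambda>d. r - d", OF V_deriv[OF rd]]) (auto intro!: derivative_eq_intros)
    thus "((\<lambda>d. - exp (- lam * d) * V (r - d)) has_real_derivative ?f d) (at d)"
      unfolding offer_value_def by (auto intro!: derivative_eq_intros simp: algebra_simps)
    have "isCont offer_value (r - d)"
      unfolding offer_value_def using V_cont
      by (intro continuous_intros drift_cont[OF rd])
        (auto simp: continuous_on_eq_continuous_at)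
    hence "isCont (\<lambda>d. offer_value (r - d)) d"
      by (rule isCont_o2[where f = "\<lambda>d. r - d" and g = offer_value, rotated]) (intro continuous_intros)
    thus "isCont ?f d" by (intro continuous_intros)
  qed
  thus ?thesis by simp
qed

lemma discounted_payoff_nonneg: "d \<in> {0..r} \<Longrightarrow> 0 \<le> lam * exp (- lam * d) * offer_value (r - d)"
  using lam_pos offer_value_nonneg[of "r - d"] by auto

text \<open>After an acceptance nothing more is to be gained, hence the value \<open>0\<close> in the state \<open>-1\<close>.\<close>

definition state_value :: "real \<Rightarrow> ennreal" where
  "state_value r = (if r < 0 then 0 else ennreal (V r))"

lemma measurable_state_value [measurable]: "state_value \<in> borel_measurable borel"
  unfolding state_value_def by measurable

text \<open>The martingale property. With probability \<open>exp (- lam * r)\<close> no offer arrives before the deadline, and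
the value is then \<open>V 0\<close>; this compensates the boundary term of the preceding integral.\<close>

lemma value_one_step:
  "(\<integral>\<^sup>+d. (\<integral>\<^sup>+x. gain m h r d x + state_value (search_step m r d x) \<partial>N) \<partial>arrival_law) = state_value r"
proof (cases "r < 0")
  case True
  thus ?thesis by (simp add: gain_def state_value_def search_step_def)
next
  case False
  hence r: "0 \<le> r" by simp
  note has = discounted_integral[OF r]
  have disc: "(\<integral>\<^sup>+d. ennreal (lam * exp (- lam * d) * offer_value (r - d)) * indicator {0..r} d \<partial>lborel) =
    ennreal (V r - exp (- lam * r) * V 0)"
    by (rule nn_integral_has_integral_lebesgue'[OF discounted_payoff_nonneg has])
  have disc_nonneg: "0 \<le> V r - exp (- lam * r) * V 0"
    by (rule has_integral_nonneg[OF has discounted_payoff_nonneg])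
  have inner: "(\<integral>\<^sup>+x. gain m h r d x + state_value (search_step m r d x) \<partial>N) =
    (if d < r then ennreal (offer_value (r - d)) else ennreal (V 0))" for d
  proof (cases "d < r")
    case True
    have "(\<integral>\<^sup>+x. gain m h r d x + state_value (search_step m r d x) \<partial>N) =
      (\<integral>\<^sup>+x. (if m (r - d) \<le> x then ennreal (h x) else ennreal (V (r - d))) \<partial>N)"
      using True r by (intro nn_integral_cong) (auto simp: gain_def search_step_def state_value_def)
    thus ?thesis using True nn_integral_offer_value[of "r - d"] by simp
  next
    case False
    thus ?thesis using r offer.emeasure_space_1
      by (simp add: gain_def search_step_def state_value_def max_def not_less)
  qed
  have "(\<integral>\<^sup>+d. (\<integral>\<^sup>+x. gain m h r d x + state_value (search_step m r d x) \<partial>N) \<partial>arrival_law) =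
    (\<integral>\<^sup>+d. ennreal (exponential_density lam d) *
      (if d < r then ennreal (offer_value (r - d)) else ennreal (V 0)) \<partial>lborel)"
    unfolding inner by (rule nn_integral_density) measurable
  also have "\<dots> = (\<integral>\<^sup>+d. ennreal (lam * exp (- lam * d) * offer_value (r - d)) * indicator {0..r} d +
      ennreal (lam * exp (- lam * d) * V 0) * indicator {r..} d \<partial>lborel)"
  proof (rule nn_integral_cong_AE)
    show "AE d in lborel. ennreal (exponential_density lam d) *
        (if d < r then ennreal (offer_value (r - d)) else ennreal (V 0)) =
      ennreal (lam * exp (- lam * d) * offer_value (r - d)) * indicator {0..r} d +
      ennreal (lam * exp (- lam * d) * V 0) * indicator {r..} d"
      \<comment> \<open>the two indicator sets overlap at \<open>d = r\<close>\<close>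
      using AE_lborel_singleton[of r]
    proof eventually_elim
      case (elim d)
      thus ?case using r lam_pos
        by (auto simp: exponential_density_def indicator_def ennreal_mult'[symmetric] ennreal_mult''[symmetric]
            V_nonneg mult_ac)
    qed
  qed
  also have "\<dots> = ennreal (V r - exp (- lam * r) * V 0) +
      (\<integral>\<^sup>+d. ennreal (lam * exp (- lam * d) * V 0) * indicator {r..} d \<partial>lborel)"
    by (subst nn_integral_add) (auto simp: disc[simplified])
  also have "(\<integral>\<^sup>+d. ennreal (lam * exp (- lam * d) * V 0) * indicator {r..} d \<partial>lborel) =
    ennreal (0 - (- exp (- lam * r) * V 0))"
  proof (rule nn_integral_FTC_atLeast)
    show "((\<lambda>d. - exp (- lam * d) * V 0) has_real_derivative lam * exp (- lam * d) * V 0) (at d)" for d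
      by (auto intro!: derivative_eq_intros)
    have "filterlim (\<lambda>d. - lam * d) at_bot at_top"
      using lam_pos by (intro filterlim_tendsto_neg_mult_at_bot[OF tendsto_const])
        (auto simp: filterlim_ident)
    hence "((\<lambda>d. exp (- lam * d)) \<longlongrightarrow> 0) at_top"
      by (rule filterlim_compose[OF exp_at_bot])
    hence "((\<lambda>d. - exp (- lam * d) * V 0) \<longlongrightarrow> - 0 * V 0) at_top"
      by (intro tendsto_intros)
    thus "((\<lambda>d. - exp (- lam * d) * V 0) \<longlongrightarrow> 0) at_top" by simp
  qed (use lam_pos V_nonneg in auto)
  also have "ennreal (V r - exp (- lam * r) * V 0) + ennreal (0 - (- exp (- lam * r) * V 0)) =
    ennreal (V r)"
    using disc_nonneg V_nonneg[of 0] by (subst ennreal_plus[symmetric]) auto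
  finally show ?thesis using r by (simp add: state_value_def)
qed

lemma expected_value_step:
  "(\<integral>\<^sup>+\<omega>. state_value (state t n \<omega>) \<partial>P) =
   (\<integral>\<^sup>+\<omega>. gain m h (state t n \<omega>) (D (Suc n) \<omega>) (X (Suc n) \<omega>) \<partial>P) + (\<integral>\<^sup>+\<omega>. state_value (state t (Suc n) \<omega>) \<partial>P)"
proof -
  have [measurable]: "D (Suc n) \<in> borel_measurable P" "X (Suc n) \<in> borel_measurable P"
    by (auto intro: measurable_D measurable_X)
  have "(\<integral>\<^sup>+\<omega>. state_value (state t n \<omega>) \<partial>P) =
    (\<integral>\<^sup>+\<omega>. (\<integral>\<^sup>+d. (\<integral>\<^sup>+x. gain m h (state t n \<omega>) d x + state_value (search_step m (state t n \<omega>) d x) \<partial>N) \<partial>arrival_law) \<partial>P)"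
    by (simp add: value_one_step)
  also have "\<dots> = (\<integral>\<^sup>+\<omega>. gain m h (state t n \<omega>) (D (Suc n) \<omega>) (X (Suc n) \<omega>) +
      state_value (search_step m (state t n \<omega>) (D (Suc n) \<omega>) (X (Suc n) \<omega>)) \<partial>P)"
    by (rule nn_integral_next[symmetric]) measurable
  also have "\<dots> = (\<integral>\<^sup>+\<omega>. gain m h (state t n \<omega>) (D (Suc n) \<omega>) (X (Suc n) \<omega>) \<partial>P) +
      (\<integral>\<^sup>+\<omega>. state_value (state t (Suc n) \<omega>) \<partial>P)"
    by (subst nn_integral_add) auto
  finally show ?thesis .
qed

lemma expected_value_sum:
  "(\<integral>\<^sup>+\<omega>. state_value (state t 0 \<omega>) \<partial>P) =
   (\<Sum>k<n. \<integral>\<^sup>+\<omega>. gain m h (state t k \<omega>) (D (Suc k) \<omega>) (X (Suc k) \<omega>) \<partial>P) +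
   (\<integral>\<^sup>+\<omega>. state_value (state t n \<omega>) \<partial>P)"
proof (induction n)
  case 0
  show ?case by simp
next
  case (Suc n)
  note Suc.IH
  also note expected_value_step[of t n]
  finally show ?case by (simp only: sum.lessThan_Suc add.assoc)
qed

abbreviation accepted :: "real \<Rightarrow> 'a \<Rightarrow> bool" where
  "accepted t \<omega> \<equiv> \<exists>i. acceptable m (\<lambda>i. D i \<omega>) (\<lambda>i. X i \<omega>) t i"

abbreviation price :: "real \<Rightarrow> 'a \<Rightarrow> real" where
  "price t \<omega> \<equiv> sale_price m (\<lambda>i. D i \<omega>) (\<lambda>i. X i \<omega>) t"

lemma suminf_gain_price:
  assumes "0 \<le> t"
  shows "(\<Sum>n. gain m h (state t n \<omega>) (D (Suc n) \<omega>) (X (Suc n) \<omega>)) =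
    (if accepted t \<omega> then ennreal (h (price t \<omega>)) else 0)"
  using suminf_gain[OF assms, of m h "\<lambda>i. D i \<omega>" "\<lambda>i. X i \<omega>"] by (simp add: sale_price_def)

lemma accepted_iff_state:
  assumes "0 \<le> t"
  shows "accepted t \<omega> \<longleftrightarrow> (\<exists>n. state t n \<omega> = -1)"
proof
  assume "accepted t \<omega>"
  then obtain i where "acceptable m (\<lambda>i. D i \<omega>) (\<lambda>i. X i \<omega>) t i" by blast
  hence "state t i \<omega> = -1" by (auto simp: search_state_eq[OF assms])
  thus "\<exists>n. state t n \<omega> = -1" by blast
next
  assume "\<exists>n. state t n \<omega> = -1"
  then obtain n where n: "state t n \<omega> = -1" by blast
  show "accepted t \<omega>"
  proof (rule ccontr)
    assume "\<not> accepted t \<omega>"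
    with n have "time_left (\<lambda>i. D i \<omega>) t n = -1" by (simp add: search_state_eq[OF assms])
    with time_left_nonneg[OF assms, of "\<lambda>i. D i \<omega>" n] show False by simp
  qed
qed

lemma state_value_limit:
  assumes "0 \<le> t"
  shows "AE \<omega> in P. (\<lambda>n. state_value (state t n \<omega>)) \<longlonglongrightarrow> (if accepted t \<omega> then 0 else ennreal (V 0))"
  using AE_deadline_reached[of t] AE_arrival_nonneg
proof eventually_elim
  case (elim \<omega>)
  then obtain n0 where n0: "time_left (\<lambda>i. D i \<omega>) t n0 \<le> 0" by blast
  have zero: "time_left (\<lambda>i. D i \<omega>) t n = 0" if "n0 \<le> n" for n
    using that
  proof (induction rule: dec_induct)
    case base
    show ?case using n0 time_left_nonneg[OF assms, of "\<lambda>i. D i \<omega>" n0] by simp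
  next
    case (step n)
    thus ?case using elim by (simp add: max_def)
  qed
  show ?case
  proof (cases "accepted t \<omega>")
    case True
    then obtain i where i: "acceptable m (\<lambda>i. D i \<omega>) (\<lambda>i. X i \<omega>) t i" by blast
    have "\<forall>\<^sub>F n in sequentially. state_value (state t n \<omega>) = 0"
      using eventually_ge_at_top[of i]
      by eventually_elim (use i in \<open>auto simp: search_state_eq[OF assms] state_value_def\<close>)
    thus ?thesis using True by (simp add: tendsto_eventually)
  next
    case False
    have "\<forall>\<^sub>F n in sequentially. state_value (state t n \<omega>) = ennreal (V 0)"
      using eventually_ge_at_top[of n0]
      by eventually_elim (use False zero in \<open>auto simp: search_state_eq[OF assms] state_value_def\<close>)
    thus ?thesis using False by (simp add: tendsto_eventually)
  qed
qed

lemma state_value_bounded: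
  assumes "0 \<le> t" and B: "0 \<le> B" "\<And>s. 0 \<le> s \<Longrightarrow> s \<le> t \<Longrightarrow> V s \<le> B"
  shows "AE \<omega> in P. state_value (state t n \<omega>) \<le> ennreal B"
  using AE_arrival_nonneg
proof eventually_elim
  case (elim \<omega>)
  have "time_left (\<lambda>i. D i \<omega>) t n \<le> t"
  proof (induction n)
    case (Suc n)
    moreover have "0 \<le> D (Suc n) \<omega>" using elim by simp
    ultimately show ?case using assms(1) by auto
  qed simp
  thus ?case
    using B time_left_nonneg[OF assms(1), of "\<lambda>i. D i \<omega>" n]
    by (auto simp: search_state_eq[OF assms(1)] state_value_def intro!: ennreal_leI)
qed

lemma measurable_accepted [measurable]:
  assumes "0 \<le> t"
  shows "Measurable.pred P (accepted t)"
  unfolding accepted_iff_state[OF assms] by measurable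

text \<open>The limit of the preceding identity over the number of offers. The gains converge monotonically; the
values of the states are bounded and settle at \<open>0\<close> or \<open>V 0\<close>, since the deadline is reached almost
surely.\<close>

lemma value_decomposition:
  assumes "0 \<le> t"
  shows "ennreal (V t) =
    (\<integral>\<^sup>+\<omega>. (if accepted t \<omega> then ennreal (h (price t \<omega>)) else 0) \<partial>P) +
    ennreal (V 0 * measure P {\<omega> \<in> space P. \<not> accepted t \<omega>})"
proof -
  note [measurable] = measurable_accepted[OF assms]
  have [measurable]: "D (Suc n) \<in> borel_measurable P" "X (Suc n) \<in> borel_measurable P" for n
    by (auto intro: measurable_D measurable_X)
  let ?g = "\<lambda>n \<omega>. gain m h (state t n \<omega>) (D (Suc n) \<omega>) (X (Suc n) \<omega>)"
  obtain B where B: "0 \<le> B" "\<And>s. 0 \<le> s \<Longrightarrow> s \<le> t \<Longrightarrow> V s \<le> B" using V_bounded[of t] by blast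
  have "(\<lambda>n. \<integral>\<^sup>+\<omega>. state_value (state t n \<omega>) \<partial>P) \<longlonglongrightarrow>
      (\<integral>\<^sup>+\<omega>. (if accepted t \<omega> then 0 else ennreal (V 0)) \<partial>P)"
    by (rule nn_integral_dominated_convergence[where w = "\<lambda>_. ennreal B"])
      (use state_value_bounded[OF assms B] state_value_limit[OF assms] in \<open>auto simp: emeasure_space_1\<close>)
  moreover have "(\<lambda>n. \<Sum>k<n. \<integral>\<^sup>+\<omega>. ?g k \<omega> \<partial>P) \<longlonglongrightarrow> (\<Sum>k. \<integral>\<^sup>+\<omega>. ?g k \<omega> \<partial>P)"
    by (rule summable_LIMSEQ) simp
  ultimately have "(\<lambda>n. (\<Sum>k<n. \<integral>\<^sup>+\<omega>. ?g k \<omega> \<partial>P) + (\<integral>\<^sup>+\<omega>. state_value (state t n \<omega>) \<partial>P)) \<longlonglongrightarrow>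
      (\<Sum>k. \<integral>\<^sup>+\<omega>. ?g k \<omega> \<partial>P) + (\<integral>\<^sup>+\<omega>. (if accepted t \<omega> then 0 else ennreal (V 0)) \<partial>P)"
    by (intro tendsto_add)
  hence "(\<integral>\<^sup>+\<omega>. state_value (state t 0 \<omega>) \<partial>P) =
      (\<Sum>k. \<integral>\<^sup>+\<omega>. ?g k \<omega> \<partial>P) + (\<integral>\<^sup>+\<omega>. (if accepted t \<omega> then 0 else ennreal (V 0)) \<partial>P)"
    unfolding expected_value_sum[symmetric] by (rule LIMSEQ_unique[OF tendsto_const])
  moreover have "(\<integral>\<^sup>+\<omega>. state_value (state t 0 \<omega>) \<partial>P) = ennreal (V t)"
    using assms by (simp add: state_value_def emeasure_space_1)
  moreover have "(\<Sum>k. \<integral>\<^sup>+\<omega>. ?g k \<omega> \<partial>P) =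
      (\<integral>\<^sup>+\<omega>. (if accepted t \<omega> then ennreal (h (price t \<omega>)) else 0) \<partial>P)"
    by (subst nn_integral_suminf[symmetric])
      (auto simp: suminf_gain_price[OF assms])
  moreover have "(\<integral>\<^sup>+\<omega>. (if accepted t \<omega> then 0 else ennreal (V 0)) \<partial>P) =
      (\<integral>\<^sup>+\<omega>. ennreal (V 0) * indicator {\<omega> \<in> space P. \<not> accepted t \<omega>} \<omega> \<partial>P)"
    by (intro nn_integral_cong) (auto simp: indicator_def)
  moreover have "\<dots> = ennreal (V 0 * measure P {\<omega> \<in> space P. \<not> accepted t \<omega>})"
    using V_nonneg[of 0]
    by (subst nn_integral_cmult_indicator) (measurable, simp add: emeasure_eq_measure ennreal_mult')
  ultimately show ?thesis by simp
qed

text \<open>Whether an offer is accepted is decided by the variables with positive index.\<close>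

lemma indep_residual_accepted:
  assumes "0 \<le> t"
  shows "indep_var borel (\<lambda>\<omega>. if accepted t \<omega> then 0 else 1 :: real) borel (X 0)"
proof -
  define A where "A = ({1..} <+> {1..} :: (nat + nat) set)"
  define B where "B = ({Inr 0} :: (nat + nat) set)"
  define Y1 where "Y1 = (\<lambda>z. if \<exists>n. search_state m (\<lambda>i. z (Inl i)) (\<lambda>i. z (Inr i)) t n = -1
    then 0 else 1 :: real)"
  define Y2 where "Y2 = (\<lambda>z :: nat + nat \<Rightarrow> real. z (Inr 0))"
  have "indep_var (PiM A (\<lambda>_. borel)) (\<lambda>\<omega>. \<lambda>i\<in>A. case_sum D X i \<omega>)
                  (PiM B (\<lambda>_. borel)) (\<lambda>\<omega>. \<lambda>i\<in>B. case_sum D X i \<omega>)"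
    by (rule indep_var_restrict[OF indep]) (auto simp: A_def B_def)
  moreover have "Y1 \<in> borel_measurable (PiM A (\<lambda>_. borel))"
  proof -
    have [measurable]: "(\<lambda>z. search_state m (\<lambda>i. z (Inl i)) (\<lambda>i. z (Inr i)) t n)
        \<in> borel_measurable (PiM A (\<lambda>_. borel))" for n
      by (intro measurable_search_state measurable_threshold)
        (auto simp: A_def intro!: measurable_component_singleton)
    show ?thesis unfolding Y1_def by measurable
  qed
  moreover have "Y2 \<in> borel_measurable (PiM B (\<lambda>_. borel))"
    unfolding Y2_def by (intro measurable_component_singleton) (auto simp: B_def)
  ultimately have "indep_var borel (Y1 \<circ> (\<lambda>\<omega>. \<lambda>i\<in>A. case_sum D X i \<omega>))
    borel (Y2 \<circ> (\<lambda>\<omega>. \<lambda>i\<in>B. case_sum D X i \<omega>))"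
    by (rule indep_var_compose)
  moreover have "Y1 \<circ> (\<lambda>\<omega>. \<lambda>i\<in>A. case_sum D X i \<omega>) = (\<lambda>\<omega>. if accepted t \<omega> then 0 else 1)"
  proof
    fix \<omega>
    have "search_state m (\<lambda>i. (\<lambda>i\<in>A. case_sum D X i \<omega>) (Inl i))
        (\<lambda>i. (\<lambda>i\<in>A. case_sum D X i \<omega>) (Inr i)) t n = state t n \<omega>" for n
      by (intro search_state_cong) (auto simp: A_def)
    thus "(Y1 \<circ> (\<lambda>\<omega>. \<lambda>i\<in>A. case_sum D X i \<omega>)) \<omega> = (if accepted t \<omega> then 0 else 1)"
      by (simp add: Y1_def o_def accepted_iff_state[OF assms])
  qed
  moreover have "Y2 \<circ> (\<lambda>\<omega>. \<lambda>i\<in>B. case_sum D X i \<omega>) = X 0"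
    by (auto simp: Y2_def B_def)
  ultimately show ?thesis by simp
qed

text \<open>Without a sale the reward is \<open>h (X 0)\<close>, whose mean is \<open>V 0\<close> independently of the search. The missing
part of the reward therefore contributes exactly the term by which the gains fall short of \<open>V t\<close>.\<close>

theorem expectation_sale_price:
  assumes "0 \<le> t" and int0: "integrable P (\<lambda>\<omega>. h (X 0 \<omega>))"
    and V0: "expectation (\<lambda>\<omega>. h (X 0 \<omega>)) = V 0"
  shows "integrable P (\<lambda>\<omega>. h (price t \<omega>))" "expectation (\<lambda>\<omega>. h (price t \<omega>)) = V t"
proof -
  note [measurable] = measurable_accepted[OF assms(1)]
  have [measurable]: "D (Suc n) \<in> borel_measurable P" "X n \<in> borel_measurable P" for n
    by (auto intro: measurable_D measurable_X)
  let ?a = "\<lambda>\<omega>. if accepted t \<omega> then h (price t \<omega>) else 0"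
  let ?b = "\<lambda>\<omega>. (if accepted t \<omega> then 0 else 1) * h (X 0 \<omega>)"
  define p where "p = measure P {\<omega> \<in> space P. \<not> accepted t \<omega>}"
  have a_nonneg: "0 \<le> ?a \<omega>" for \<omega>
  proof (cases "accepted t \<omega>")
    case True
    define k where "k = (LEAST i. acceptable m (\<lambda>i. D i \<omega>) (\<lambda>i. X i \<omega>) t i)"
    have "acceptable m (\<lambda>i. D i \<omega>) (\<lambda>i. X i \<omega>) t k"
      unfolding k_def using True by (rule LeastI_ex)
    hence "0 \<le> h (X k \<omega>)"
      using accepted_reward_nonneg[of "time_left (\<lambda>i. D i \<omega>) t k" "X k \<omega>"]
      by (simp add: acceptable_def)
    thus ?thesis using True by (simp add: sale_price_def k_def)
  qed simp
  have a_gain: "ennreal (?a \<omega>) =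
      (\<Sum>n. gain m h (state t n \<omega>) (D (Suc n) \<omega>) (X (Suc n) \<omega>))" for \<omega>
    by (simp add: suminf_gain_price[OF assms(1)])
  have "?a = (\<lambda>\<omega>. enn2real (\<Sum>n. gain m h (state t n \<omega>) (D (Suc n) \<omega>) (X (Suc n) \<omega>)))"
    unfolding a_gain[symmetric] using a_nonneg by (intro ext enn2real_ennreal[symmetric])
  also have "\<dots> \<in> borel_measurable P" by measurable
  finally have a_meas: "?a \<in> borel_measurable P" .
  have dec: "ennreal (V t) = (\<integral>\<^sup>+\<omega>. ennreal (?a \<omega>) \<partial>P) + ennreal (V 0 * p)"
    unfolding value_decomposition[OF assms(1)] p_def
    by (intro arg_cong2[where f = "(+)"] nn_integral_cong) auto
  have p: "0 \<le> V 0 * p" using V_nonneg by (simp add: p_def)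
  have "(\<integral>\<^sup>+\<omega>. ennreal (?a \<omega>) \<partial>P) \<noteq> \<top>"
    using dec by (metis ennreal_add_eq_top ennreal_neq_top)
  then obtain I where I: "0 \<le> I" "(\<integral>\<^sup>+\<omega>. ennreal (?a \<omega>) \<partial>P) = ennreal I"
    by (cases "\<integral>\<^sup>+\<omega>. ennreal (?a \<omega>) \<partial>P") auto
  with dec p V_nonneg[of t] have "V t = I + V 0 * p"
    by (simp flip: ennreal_plus)
  moreover have a: "integrable P ?a \<and> expectation ?a = I"
    using a_nonneg a_meas I by (subst nn_integral_eq_integrable[symmetric]) auto
  moreover have ind: "indep_var borel (\<lambda>\<omega>. if accepted t \<omega> then 0 else 1 :: real)
      borel (\<lambda>\<omega>. h (X 0 \<omega>))"
    using indep_var_compose[OF indep_residual_accepted[OF assms(1)], of id borel h borel]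
    by (simp add: o_def)
  have int1: "integrable P (\<lambda>\<omega>. if accepted t \<omega> then 0 else 1 :: real)"
    by (rule integrable_const_bound[where B = 1]) auto
  have "expectation (\<lambda>\<omega>. if accepted t \<omega> then 0 else 1 :: real) =
      expectation (indicator {\<omega> \<in> space P. \<not> accepted t \<omega>})"
    by (intro Bochner_Integration.integral_cong) (auto simp: indicator_def)
  hence "expectation (\<lambda>\<omega>. if accepted t \<omega> then 0 else 1 :: real) = p"
    by (simp add: p_def Int_absorb2)
  with indep_var_lebesgue_integral[OF ind int1 int0] V0 have "expectation ?b = p * V 0" by simp
  moreover have "integrable P ?b" by (rule indep_var_integrable[OF ind int1 int0])
  moreover have "(\<lambda>\<omega>. h (price t \<omega>)) = (\<lambda>\<omega>. ?a \<omega> + ?b \<omega>)"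
    by (auto simp: sale_price_def)
  ultimately show "integrable P (\<lambda>\<omega>. h (price t \<omega>))" "expectation (\<lambda>\<omega>. h (price t \<omega>)) = V t"
    by (simp_all add: Bochner_Integration.integral_add mult.commute)
qed

end

section \<open>Asymptotics along the optimal policy\<close>

locale exponential_tail = bidding_policy N \<mu>\<^sub>0 r for N \<mu>\<^sub>0 r +
  fixes c :: real
  assumes c_pos: "0 < c" and start_nonneg: "0 \<le> \<mu>\<^sub>0"
    and tail_ratio: "((\<lambda>x. \<phi> x / \<Phi> x) \<longlongrightarrow> c) at_top"
begin

text \<open>The Bochner integral of a function that is not integrable is \<open>0\<close>, which would make the ratio in the
limit hypothesis vanish. A positive limit hence contains the finiteness of \<open>\<Phi>\<close>.\<close>

lemma tail_integral_integrable: "set_integrable lborel {x..} \<phi>"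
proof -
  have "\<forall>\<^sub>F x in at_top. \<phi> x / \<Phi> x > 0"
    using tail_ratio c_pos by (rule order_tendstoD)
  then obtain a where "\<phi> a / \<Phi> a > 0" by (auto simp: eventually_at_top_linorder)
  hence "\<Phi> a \<noteq> 0" by auto
  hence "set_integrable lborel {a..} \<phi>"
    unfolding set_integrable_def set_lebesgue_integral_def
    using not_integrable_integral_eq by blast
  thus ?thesis by (rule tail_integral_set_integrable)
qed

lemmas \<Phi>_pos = double_tail_pos[OF tail_integral_integrable]
  and \<Phi>_deriv = double_tail_deriv[OF tail_integral_integrable]

lemma isCont_\<Phi>: "isCont \<Phi> x"
  by (rule DERIV_isCont[OF \<Phi>_deriv])

lemma \<phi>_nonzero: "\<phi> x \<noteq> 0" and \<Phi>_nonzero: "\<Phi> x \<noteq> 0"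
  using tail_integral_pos[of x] \<Phi>_pos[of x] by auto

lemma policy_tail_ratio: "((\<lambda>t. \<phi> (\<mu> t) / \<Phi> (\<mu> t)) \<longlongrightarrow> c) at_top"
  by (rule filterlim_compose[OF tail_ratio policy_at_top])

text \<open>The function \<open>g = \<Phi>(\<mu>)\<close> satisfies \<open>g' = - r (\<phi> / \<Phi>)\<^sup>2 g\<^sup>2\<close>. Passing to the reciprocal removes the
factor \<open>g\<^sup>2\<close> and leaves a derivative that converges.\<close>

lemma double_tail_along_policy: "((\<lambda>t. t * \<Phi> (\<mu> t)) \<longlongrightarrow> 1 / (r * c\<^sup>2)) at_top"
proof -
  have "((\<lambda>t. (1 / \<Phi> (\<mu> t)) / t) \<longlongrightarrow> r * c\<^sup>2) at_top"
  proof (rule lhospital_at_top_at_top)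
    show "\<forall>\<^sub>F t in at_top. ((\<lambda>t. 1 / \<Phi> (\<mu> t)) has_real_derivative
        r * (\<phi> (\<mu> t) / \<Phi> (\<mu> t))\<^sup>2) (at t)"
      using eventually_gt_at_top[of 0]
    proof eventually_elim
      case (elim t)
      have "((\<lambda>t. \<Phi> (\<mu> t)) has_real_derivative - \<phi> (\<mu> t) * (r * \<phi> (\<mu> t))) (at t)"
        by (rule DERIV_chain2[OF \<Phi>_deriv policy_deriv[OF elim]])
      from DERIV_inverse'[OF this \<Phi>_nonzero] show ?case
        by (simp add: field_simps power2_eq_square)
    qed
    show "((\<lambda>t. r * (\<phi> (\<mu> t) / \<Phi> (\<mu> t))\<^sup>2 / 1) \<longlongrightarrow> r * c\<^sup>2) at_top"
      using policy_tail_ratio by (auto intro!: tendsto_intros)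
  qed (auto simp: filterlim_ident)
  hence "((\<lambda>t. inverse ((1 / \<Phi> (\<mu> t)) / t)) \<longlongrightarrow> inverse (r * c\<^sup>2)) at_top"
    using rate_pos c_pos by (intro tendsto_inverse) auto
  thus ?thesis by (simp add: field_simps)
qed

lemma tail_along_policy: "((\<lambda>t. t * \<phi> (\<mu> t)) \<longlongrightarrow> 1 / (r * c)) at_top"
proof -
  have "((\<lambda>t. (\<phi> (\<mu> t) / \<Phi> (\<mu> t)) * (t * \<Phi> (\<mu> t))) \<longlongrightarrow> c * (1 / (r * c\<^sup>2))) at_top"
    by (intro tendsto_mult policy_tail_ratio double_tail_along_policy)
  thus ?thesis
    using c_pos \<Phi>_nonzero by (simp add: power2_eq_square mult.commute)
qed

lemma tail_along_policy_0: "((\<lambda>t. \<phi> (\<mu> t)) \<longlongrightarrow> 0) at_top"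
proof -
  have "((\<lambda>t. (t * \<phi> (\<mu> t)) * inverse t) \<longlongrightarrow> 1 / (r * c) * 0) at_top"
    by (intro tendsto_mult tail_along_policy tendsto_inverse_0_at_top filterlim_ident)
  hence "((\<lambda>t. (t * \<phi> (\<mu> t)) * inverse t) \<longlongrightarrow> 0) at_top"
    by (simp only: mult_zero_right)
  thus ?thesis
    by (rule Lim_transform_eventually) (auto intro: eventually_mono[OF eventually_gt_at_top[of 0]])
qed

theorem policy_asymp: "\<mu> \<sim>[at_top] (\<lambda>t. 1 / c * ln t)"
proof -
  have "((\<lambda>t. \<mu> t / ln t) \<longlongrightarrow> 1 / c) at_top"
  proof (rule lhospital_at_top_at_top)
    show "\<forall>\<^sub>F t in at_top. (\<mu> has_real_derivative r * \<phi> (\<mu> t)) (at t)"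
      using eventually_gt_at_top[of 0] by eventually_elim (rule policy_deriv)
    show "\<forall>\<^sub>F t :: real in at_top. (ln has_real_derivative 1 / t) (at t)"
      using eventually_gt_at_top[of 0] by eventually_elim (auto intro!: derivative_eq_intros)
    show "\<forall>\<^sub>F t :: real in at_top. 1 / t \<noteq> 0"
      using eventually_gt_at_top[of 0] by eventually_elim auto
    have "((\<lambda>t. r * (t * \<phi> (\<mu> t))) \<longlongrightarrow> r * (1 / (r * c))) at_top"
      by (intro tendsto_mult_left tail_along_policy)
    thus "((\<lambda>t. r * \<phi> (\<mu> t) / (1 / t)) \<longlongrightarrow> 1 / c) at_top"
      using rate_pos by (simp add: mult_ac)
  qed (rule ln_at_top)
  hence "((\<lambda>t. c * (\<mu> t / ln t)) \<longlongrightarrow> c * (1 / c)) at_top"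
    by (rule tendsto_mult_left)
  thus ?thesis using c_pos by (intro asymp_equivI') (simp add: mult_ac)
qed

theorem policy_deriv_asymp: "deriv \<mu> \<sim>[at_top] (\<lambda>t. 1 / (c * t))"
proof (rule asymp_equivI')
  have "((\<lambda>t. c * r * (t * \<phi> (\<mu> t))) \<longlongrightarrow> c * r * (1 / (r * c))) at_top"
    by (intro tendsto_mult_left tail_along_policy)
  hence "((\<lambda>t. c * r * (t * \<phi> (\<mu> t))) \<longlongrightarrow> 1) at_top"
    using c_pos rate_pos by simp
  thus "((\<lambda>t. deriv \<mu> t / (1 / (c * t))) \<longlongrightarrow> 1) at_top"
    by (rule Lim_transform_eventually)
      (auto intro: eventually_mono[OF eventually_gt_at_top[of 0]] simp: DERIV_imp_deriv[OF policy_deriv])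
qed

definition accumulated :: "real \<Rightarrow> real" where
  "accumulated t = integral {0..t} (\<lambda>s. 2 * r * \<Phi> (\<mu> s) / \<phi> (\<mu> s))"

text \<open>The solution of \<open>v' = 2 r \<Phi>(\<mu>) - r v P(X \<ge> \<mu>)\<close> with \<open>v 0 = v0\<close>, found by variation of constants: \<open>\<phi>(\<mu>)\<close>
solves the homogeneous equation.\<close>

definition price_variance :: "real \<Rightarrow> real \<Rightarrow> real" where
  "price_variance v0 t = \<phi> (\<mu> t) * (v0 / \<phi> \<mu>\<^sub>0 + accumulated t)"

lemma continuous_on_accumulation_rate: "continuous_on {0..} (\<lambda>s. 2 * r * \<Phi> (\<mu> s) / \<phi> (\<mu> s))"
proof -
  have "continuous_on UNIV \<Phi>"
    using isCont_\<Phi> by (simp add: continuous_on_eq_continuous_at)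
  thus ?thesis
    using \<phi>_nonzero
    by (intro continuous_intros continuous_on_compose2[OF _ continuous_on_policy, of UNIV \<Phi>]
        continuous_on_compose2[OF continuous_on_tail_integral continuous_on_policy, of UNIV]) auto
qed

lemma accumulation_rate_integrable:
  "(\<lambda>s. 2 * r * \<Phi> (\<mu> s) / \<phi> (\<mu> s)) integrable_on {0..t}"
  by (intro integrable_continuous_real continuous_on_subset[OF continuous_on_accumulation_rate]) auto

lemma accumulated_deriv:
  assumes "0 < t"
  shows "(accumulated has_real_derivative 2 * r * \<Phi> (\<mu> t) / \<phi> (\<mu> t)) (at t)"
proof -
  have "(accumulated has_real_derivative 2 * r * \<Phi> (\<mu> t) / \<phi> (\<mu> t)) (at t within {0..t + 1})"
    unfolding accumulated_def[abs_def] using assms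
    by (intro integral_has_real_derivative continuous_on_subset[OF continuous_on_accumulation_rate]) auto
  thus ?thesis using assms by (simp add: at_within_Icc_at)
qed

lemma accumulated_nonneg: "0 \<le> accumulated t"
  unfolding accumulated_def using tail_integral_pos \<Phi>_pos rate_pos
  by (intro integral_nonneg accumulation_rate_integrable) (auto simp: less_imp_le)

lemma continuous_on_accumulated: "continuous_on {0..} accumulated"
proof -
  have "isCont (\<lambda>t. accumulated (max t 0)) t" for t
  proof -
    have "continuous_on {0..\<bar>t\<bar> + 1} accumulated"
      unfolding accumulated_def[abs_def]
      by (rule indefinite_integral_continuous_1[OF accumulation_rate_integrable])
    hence "continuous_on {-\<bar>t\<bar> - 1..\<bar>t\<bar> + 1} (\<lambda>t. accumulated (max t 0))"
      by (rule continuous_on_compose2) (auto intro!: continuous_intros)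
    thus ?thesis by (rule continuous_on_interior) auto
  qed
  hence "continuous_on {0..} (\<lambda>t. accumulated (max t 0))"
    by (intro continuous_at_imp_continuous_on) auto
  thus ?thesis by (rule continuous_on_eq) auto
qed

lemma price_variance_0: "price_variance v0 0 = v0"
  using \<phi>_nonzero by (simp add: price_variance_def accumulated_def policy_0)

lemma price_variance_nonneg: "0 \<le> v0 \<Longrightarrow> 0 \<le> price_variance v0 t"
  unfolding price_variance_def using tail_integral_pos accumulated_nonneg
  by (intro mult_nonneg_nonneg add_nonneg_nonneg divide_nonneg_pos) (auto simp: less_imp_le)

lemma continuous_on_price_variance: "continuous_on {0..} (price_variance v0)"
  unfolding price_variance_def[abs_def]
  by (intro continuous_intros continuous_on_accumulated
      continuous_on_compose2[OF continuous_on_tail_integral continuous_on_policy, of UNIV])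
    (use \<phi>_nonzero in auto)

lemma price_variance_deriv:
  assumes "0 < t" "isCont (cdf N) (\<mu> t)"
  shows "(price_variance v0 has_real_derivative
    2 * r * \<Phi> (\<mu> t) - r * price_variance v0 t * measure N {\<mu> t..}) (at t)"
proof -
  have "((\<lambda>t. \<phi> (\<mu> t)) has_real_derivative - measure N {\<mu> t<..} * (r * \<phi> (\<mu> t))) (at t)"
    by (rule DERIV_chain2[OF tail_integral_deriv[OF assms(2)] policy_deriv[OF assms(1)]])
  moreover have "((\<lambda>t. v0 / \<phi> \<mu>\<^sub>0 + accumulated t) has_real_derivative
      2 * r * \<Phi> (\<mu> t) / \<phi> (\<mu> t)) (at t)"
    using accumulated_deriv[OF assms(1)] by (auto intro!: derivative_eq_intros)
  ultimately have "((\<lambda>t. \<phi> (\<mu> t) * (v0 / \<phi> \<mu>\<^sub>0 + accumulated t)) has_real_derivative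
      - measure N {\<mu> t<..} * (r * \<phi> (\<mu> t)) * (v0 / \<phi> \<mu>\<^sub>0 + accumulated t) +
      2 * r * \<Phi> (\<mu> t) / \<phi> (\<mu> t) * \<phi> (\<mu> t)) (at t)"
    by (rule DERIV_mult)
  thus ?thesis
    unfolding price_variance_def[abs_def] isCont_closed_tail(2)[OF assms(2)]
    using \<phi>_nonzero by (simp add: algebra_simps)
qed

text \<open>By l'Hospital's rule the accumulated term grows like \<open>2 r t / c\<close>, while \<open>\<phi>(\<mu> t)\<close> decays like
\<open>1 / (r c t)\<close>.\<close>

theorem price_variance_limit: "(price_variance v0 \<longlongrightarrow> 2 / c\<^sup>2) at_top"
proof -
  have acc: "((\<lambda>t. accumulated t / t) \<longlongrightarrow> 2 * r / c) at_top"
  proof (rule lhospital_at_top_at_top)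
    show "\<forall>\<^sub>F t in at_top. (accumulated has_real_derivative 2 * r * \<Phi> (\<mu> t) / \<phi> (\<mu> t)) (at t)"
      using eventually_gt_at_top[of 0] by eventually_elim (rule accumulated_deriv)
    have "((\<lambda>t. 2 * r / (\<phi> (\<mu> t) / \<Phi> (\<mu> t))) \<longlongrightarrow> 2 * r / c) at_top"
      using c_pos by (intro tendsto_divide tendsto_const policy_tail_ratio) auto
    thus "((\<lambda>t. 2 * r * \<Phi> (\<mu> t) / \<phi> (\<mu> t) / 1) \<longlongrightarrow> 2 * r / c) at_top" by simp
  qed (auto simp: filterlim_ident)
  have "((\<lambda>t. \<phi> (\<mu> t) * (v0 / \<phi> \<mu>\<^sub>0) + (t * \<phi> (\<mu> t)) * (accumulated t / t)) \<longlongrightarrow>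
      0 * (v0 / \<phi> \<mu>\<^sub>0) + 1 / (r * c) * (2 * r / c)) at_top"
    by (intro tendsto_add tendsto_mult tendsto_const tail_along_policy_0 tail_along_policy acc)
  moreover have "0 * (v0 / \<phi> \<mu>\<^sub>0) + 1 / (r * c) * (2 * r / c) = 2 / c\<^sup>2"
    using rate_pos c_pos by (simp add: power2_eq_square)
  ultimately have "((\<lambda>t. \<phi> (\<mu> t) * (v0 / \<phi> \<mu>\<^sub>0) + (t * \<phi> (\<mu> t)) * (accumulated t / t)) \<longlongrightarrow>
      2 / c\<^sup>2) at_top" by simp
  moreover have "\<forall>\<^sub>F t in at_top. \<phi> (\<mu> t) * (v0 / \<phi> \<mu>\<^sub>0) + (t * \<phi> (\<mu> t)) * (accumulated t / t) =
      price_variance v0 t"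
    using eventually_gt_at_top[of 0]
    by eventually_elim (simp add: price_variance_def distrib_left)
  ultimately show ?thesis by (rule Lim_transform_eventually)
qed

end

section \<open>Mean and variance of the sale price\<close>

context exponential_tail
begin

text \<open>The policy continued as a constant to negative times. Unlike \<open>\<mu>\<close>, whose values there are
unspecified, it is monotone and continuous everywhere.\<close>

definition threshold :: "real \<Rightarrow> real" where
  "threshold s = \<mu> (max s 0)"

lemma threshold_mono: "mono threshold"
  unfolding threshold_def by (intro monoI policy_mono) auto

lemma threshold_ge: "\<mu>\<^sub>0 \<le> threshold s"
  unfolding threshold_def by (intro policy_ge) auto

lemma continuous_on_clamp:
  assumes "continuous_on {0..} f"
  shows "continuous_on UNIV (\<lambda>s. f (max s 0 :: real) :: real)"
  by (rule continuous_on_compose2[OF assms]) (auto intro!: continuous_intros)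

lemma deriv_clamp:
  assumes "0 < s" "(f has_real_derivative D) (at s)"
  shows "((\<lambda>s. f (max s 0)) has_real_derivative D) (at s)"
  by (rule has_field_derivative_transform_within_open[OF assms(2), where S = "{0<..}"])
    (use assms(1) in auto)

lemma continuous_on_threshold: "continuous_on UNIV threshold"
  unfolding threshold_def[abs_def] by (rule continuous_on_clamp[OF continuous_on_policy])

lemma isCont_threshold: "isCont threshold s"
  using continuous_on_threshold by (simp add: continuous_on_eq_continuous_at)

lemma mean_drift: "(\<integral>x. (if u \<le> x then x - u else 0) \<partial>N) = \<phi> u"
  unfolding tail_integral_eq_expectation by (intro Bochner_Integration.integral_cong) (auto simp: max_def)

text \<open>For \<open>x \<ge> u\<close> one has \<open>x\<^sup>2 - u\<^sup>2 = (x - u)\<^sup>2 + 2 u (x - u)\<close>.\<close>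

lemma square_drift:
  "(\<integral>x. (if u \<le> x then x\<^sup>2 - (u\<^sup>2 + w) else 0) \<partial>N) = 2 * \<Phi> u + 2 * u * \<phi> u - w * measure N {u..}"
proof -
  have "(\<integral>x. (if u \<le> x then x\<^sup>2 - (u\<^sup>2 + w) else 0) \<partial>N) =
    (\<integral>x. (max (x - u) 0)\<^sup>2 + 2 * u * max (x - u) 0 - w * indicator {u..} x \<partial>N)"
    by (intro Bochner_Integration.integral_cong)
      (auto simp: max_def indicator_def power2_eq_square algebra_simps)
  also have "\<dots> = (\<integral>x. (max (x - u) 0)\<^sup>2 \<partial>N) + 2 * u * (\<integral>x. max (x - u) 0 \<partial>N) - w * measure N {u..}"
  proof -
    have i1: "integrable N (\<lambda>x. (max (x - u) 0)\<^sup>2)"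
      by (rule integrable_excess_square[OF tail_integral_integrable])
    have i2: "integrable N (\<lambda>x. 2 * u * max (x - u) 0)"
      by (intro integrable_mult_right integrable_excess)
    have i3: "integrable N (\<lambda>x. w * indicator {u..} x)"
      by (intro integrable_mult_right integrable_real_indicator) (auto simp: emeasure_eq_measure)
    show ?thesis
      unfolding Bochner_Integration.integral_diff[OF Bochner_Integration.integrable_add[OF i1 i2] i3]
        Bochner_Integration.integral_add[OF i1 i2] by simp
  qed
  finally show ?thesis
    by (simp add: expectation_excess_square[OF tail_integral_integrable] tail_integral_eq_expectation)
qed

text \<open>The policy is its own value function: the mean excess of an acceptable offer over \<open>\<mu>\<close> is \<open>\<phi>(\<mu>)\<close>, and
\<open>r \<phi>(\<mu>)\<close> is the derivative of \<open>\<mu>\<close>.\<close>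

lemma search_value_mean:
  assumes "threshold_search P D X N r threshold"
  shows "search_value P D X N r threshold (\<lambda>x. x) threshold {}"
proof -
  interpret search: threshold_search P D X N r threshold by fact
  show ?thesis
  proof
    show "integrable N (\<lambda>x. if threshold 0 \<le> x then x else 0)"
      by (rule Bochner_Integration.integrable_bound[OF integrable_positive_part])
        (use threshold_ge[of 0] start_nonneg in auto)
    show "continuous_on UNIV threshold" by (rule continuous_on_threshold)
    fix s :: real
    show "0 \<le> threshold s" using threshold_ge[of s] start_nonneg by simp
    assume s: "0 < s"
    have "(threshold has_real_derivative r * \<phi> (\<mu> s)) (at s)"
      unfolding threshold_def[abs_def] by (rule deriv_clamp[OF s policy_deriv[OF s]])
    thus "(threshold has_real_derivative
        r * (\<integral>x. (if threshold s \<le> x then x - threshold s else 0) \<partial>N)) (at s)"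
      using s by (simp add: mean_drift) (simp add: threshold_def)
    show "isCont (\<lambda>s. \<integral>x. (if threshold s \<le> x then x - threshold s else 0) \<partial>N) s"
      unfolding mean_drift by (rule isCont_o2[OF isCont_threshold isCont_tail_integral])
  qed (use threshold_ge[of 0] start_nonneg in auto)
qed

text \<open>The exceptional times are those at which the policy passes an atom of the offer distribution. There
are countably many since the policy is strictly increasing.\<close>

lemma search_value_square:
  assumes "threshold_search P D X N r threshold" and v0: "0 \<le> v0"
  shows "search_value P D X N r threshold (\<lambda>x. x\<^sup>2)
    (\<lambda>s. (threshold s)\<^sup>2 + price_variance v0 (max s 0))
    {s. 0 < s \<and> \<not> isCont (cdf N) (\<mu> s)}"
proof -
  interpret search: threshold_search P D X N r threshold by fact
  let ?v = "\<lambda>s. price_variance v0 (max s 0)"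
  have v_cont: "continuous_on UNIV ?v"
    by (rule continuous_on_clamp[OF continuous_on_price_variance])
  show ?thesis
  proof
    show "integrable N (\<lambda>x. if threshold 0 \<le> x then x\<^sup>2 else 0)"
      by (rule Bochner_Integration.integrable_bound
          [OF integrable_excess_square[OF tail_integral_integrable, of 0]])
        (use threshold_ge[of 0] start_nonneg in auto)
    show "continuous_on UNIV (\<lambda>s. (threshold s)\<^sup>2 + ?v s)"
      by (intro continuous_intros continuous_on_threshold v_cont)
    show "0 \<le> (threshold s)\<^sup>2 + ?v s" for s
      using price_variance_nonneg[OF v0] by simp
    show "countable {s. 0 < s \<and> \<not> isCont (cdf N) (\<mu> s)}"
    proof (rule countable_image_inj_on)
      have "countable {x. \<not> isCont (cdf N) x}"
        by (intro mono_ctble_discont monoI cdf_nondecreasing)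
      thus "countable (\<mu> ` {s. 0 < s \<and> \<not> isCont (cdf N) (\<mu> s)})"
        by (rule countable_subset[rotated]) auto
      show "inj_on \<mu> {s. 0 < s \<and> \<not> isCont (cdf N) (\<mu> s)}"
        using policy_strict_mono by (intro linorder_inj_onI') (auto simp: less_le)
    qed
    fix s :: real
    assume s: "0 < s" and "s \<notin> {s. 0 < s \<and> \<not> isCont (cdf N) (\<mu> s)}"
    hence cont: "isCont (cdf N) (\<mu> s)" by simp
    have "((\<lambda>s. (\<mu> s)\<^sup>2 + price_variance v0 s) has_real_derivative
        2 * \<mu> s * (r * \<phi> (\<mu> s)) +
        (2 * r * \<Phi> (\<mu> s) - r * price_variance v0 s * measure N {\<mu> s..})) (at s)"
      using policy_deriv[OF s] price_variance_deriv[OF s cont]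
      by (auto intro!: derivative_eq_intros)
    from deriv_clamp[OF s this]
    show "((\<lambda>s. (threshold s)\<^sup>2 + ?v s) has_real_derivative
        r * (\<integral>x. (if threshold s \<le> x then x\<^sup>2 - ((threshold s)\<^sup>2 + ?v s) else 0) \<partial>N)) (at s)"
      unfolding square_drift using s by (simp add: threshold_def algebra_simps)
    have "isCont (cdf N) (threshold s)" using cont s by (simp add: threshold_def)
    hence "isCont (\<lambda>s. measure N {threshold s..}) s"
      by (rule isCont_o2[OF isCont_threshold isCont_closed_tail(1)])
    moreover have "isCont ?v s" using v_cont by (simp add: continuous_on_eq_continuous_at)
    ultimately
    show "isCont (\<lambda>s. \<integral>x. (if threshold s \<le> x then x\<^sup>2 - ((threshold s)\<^sup>2 + ?v s) else 0) \<partial>N) s"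
      unfolding square_drift
      by (intro continuous_intros isCont_threshold isCont_o2[OF isCont_threshold isCont_tail_integral]
          isCont_o2[OF isCont_threshold isCont_\<Phi>])
  qed auto
qed

end

text \<open>The value functions for \<open>x\<close> and \<open>x\<^sup>2\<close> are \<open>\<mu>\<close> and \<open>\<mu>\<^sup>2 + v\<close>, so \<open>v\<close> remains as the variance.\<close>

theorem (in exponential_tail) variance_sale_price:
  assumes search: "threshold_search P D X N r threshold"
    and residual: "integrable P (X 0)" "prob_space.expectation P (X 0) = \<mu>\<^sub>0"
      "integrable P (\<lambda>\<omega>. (X 0 \<omega>)\<^sup>2)" and "0 \<le> t"
  shows "prob_space.variance P (\<lambda>\<omega>. sale_price \<mu> (\<lambda>i. D i \<omega>) (\<lambda>i. X i \<omega>) t) =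
    price_variance (prob_space.variance P (X 0)) t"
proof -
  interpret S: threshold_search P D X N r threshold by (rule search)
  define v0 where "v0 = S.variance (X 0)"
  have v0: "0 \<le> v0" by (simp add: v0_def S.variance_positive)
  interpret mean: search_value P D X N r threshold "\<lambda>x. x" threshold "{}"
    by (rule search_value_mean[OF search])
  interpret sq: search_value P D X N r threshold "\<lambda>x. x\<^sup>2"
    "\<lambda>s. (threshold s)\<^sup>2 + price_variance v0 (max s 0)" "{s. 0 < s \<and> \<not> isCont (cdf N) (\<mu> s)}"
    by (rule search_value_square[OF search v0])
  let ?S = "\<lambda>\<omega>. sale_price threshold (\<lambda>i. D i \<omega>) (\<lambda>i. X i \<omega>) t"
  have eq: "sale_price \<mu> (\<lambda>i. D i \<omega>) (\<lambda>i. X i \<omega>) t = ?S \<omega>" for \<omega>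
    by (intro sale_price_cong) (simp add: threshold_def)
  have th0: "threshold 0 = \<mu>\<^sub>0" and tht: "threshold t = \<mu> t"
    using \<open>0 \<le> t\<close> by (simp_all add: threshold_def policy_0)
  have m1: "integrable P ?S" "S.expectation ?S = \<mu> t"
    using mean.expectation_sale_price[OF \<open>0 \<le> t\<close>] residual by (auto simp: th0 tht)
  have "S.expectation (\<lambda>\<omega>. (X 0 \<omega>)\<^sup>2) = (threshold 0)\<^sup>2 + price_variance v0 (max 0 0)"
    using S.variance_eq[OF residual(1,3)] residual(2)
    by (simp add: th0 price_variance_0 v0_def)
  hence m2: "integrable P (\<lambda>\<omega>. (?S \<omega>)\<^sup>2)"
    "S.expectation (\<lambda>\<omega>. (?S \<omega>)\<^sup>2) = (\<mu> t)\<^sup>2 + price_variance v0 t"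
    using sq.expectation_sale_price[OF \<open>0 \<le> t\<close> residual(3)] \<open>0 \<le> t\<close> by (auto simp: tht)
  show ?thesis
    using S.variance_eq[OF m1(1) m2(1)] unfolding eq m1(2) m2(2) v0_def[symmetric] by simp
qed

theorem theorem5p2:
  fixes P :: "'a measure"
    and D X :: "nat \<Rightarrow> 'a \<Rightarrow> real"
    and F F\<^sub>0 \<mu> :: "real \<Rightarrow> real"
    and S :: "real \<Rightarrow> 'a \<Rightarrow> real"
    and lam \<mu>\<^sub>0 c :: real
  defines "\<mu>\<^sub>0 \<equiv> prob_space.expectation P (X 0)"
    and "\<mu> \<equiv> optimal_policy lam F \<mu>\<^sub>0"
    and "S \<equiv> (\<lambda>t \<omega>. sale_price \<mu> (\<lambda>i. D i \<omega>) (\<lambda>i. X i \<omega>) t)"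
  assumes "prob_space P" and "lam > 0"
    and "prob_space.indep_vars P (\<lambda>_. borel) (case_sum D X) ({1..} <+> {0..})"
    and "\<And>i. i \<ge> 1 \<Longrightarrow> distributed P lborel (D i) (exponential_density lam)"
    and "\<And>i. i \<ge> 1 \<Longrightarrow> cdf (distr P borel (X i)) = F"
    and "cdf (distr P borel (X 0)) = F\<^sub>0"
    and "integrable P (\<lambda>\<omega>. max (X 1 \<omega>) 0)"
    and "integrable P (X 0)"
    and "0 \<le> \<mu>\<^sub>0" and "ereal \<mu>\<^sub>0 < right_endpoint F"
    and "right_endpoint F = \<infinity>"
    and "c > 0"
    and "((\<lambda>x. tail_integral F x / (LBINT u:{x..}. tail_integral F u)) \<longlongrightarrow> c) at_top"
  shows "\<mu> \<sim>[at_top] (\<lambda>t. 1 / c * ln t) \<and>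
    deriv \<mu> \<sim>[at_top] (\<lambda>t. 1 / (c * t)) \<and>
    (integrable P (\<lambda>\<omega>. (X 0 \<omega>)\<^sup>2) \<longrightarrow>
      ((\<lambda>t. prob_space.variance P (S t)) \<longlongrightarrow> 2 / c\<^sup>2) at_top)"
proof -
  interpret P: prob_space P by fact
  have X [measurable]: "X i \<in> borel_measurable P" for i
    using assms(6) unfolding P.indep_vars_def by (auto dest: bspec[of _ _ "Inr i"])
  define N where "N = distr P borel (X 1)"
  have F: "F = cdf N" using assms(8)[of 1] by (simp add: N_def)
  have real_distr: "real_distribution (distr P borel (X i))" for i
    by (rule P.real_distribution_distr) measurable
  interpret N: real_distribution N unfolding N_def by (rule real_distr)
  have distr_X: "distr P borel (X i) = N" if "1 \<le> i" for i
    using assms(8)[OF that] by (intro cdf_unique real_distr N.real_distribution_axioms) (simp add: F)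
  interpret exponential_tail N \<mu>\<^sub>0 lam c
  proof
    show "integrable N (\<lambda>y. max y 0)"
      using assms(10) unfolding N_def by (subst integrable_distr_eq) auto
    show "0 < measure N {x<..}" for x
    proof -
      have "ereal x < (SUP y\<in>{y. F y < 1}. ereal y)"
        using assms(14) by (simp add: right_endpoint_def)
      then obtain y where "F y < 1" "x < y" by (auto simp: less_SUP_iff)
      hence "cdf N x < 1" using N.cdf_nondecreasing[of x y] by (simp add: F)
      moreover have "measure N (space N - {..x}) = 1 - measure N {..x}"
        by (intro N.prob_compl) auto
      moreover have "space N - {..x} = {x<..}" by auto
      ultimately show ?thesis by (simp add: cdf_def)
    qed
  qed (use assms in \<open>auto simp: F\<close>)
  have "threshold_search P D X N lam threshold"
    by unfold_locales (use assms distr_X threshold_mono in auto)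
  note variance = variance_sale_price[OF this assms(11) \<mu>\<^sub>0_def[symmetric, THEN meta_eq_to_obj_eq]]
  have "((\<lambda>t. P.variance (S t)) \<longlongrightarrow> 2 / c\<^sup>2) at_top" if sq: "integrable P (\<lambda>\<omega>. (X 0 \<omega>)\<^sup>2)"
    using price_variance_limit[of "P.variance (X 0)"]
    by (rule Lim_transform_eventually)
      (use variance[OF sq] in \<open>auto intro!: eventually_mono[OF eventually_ge_at_top[of 0]]
        simp: S_def \<mu>_def F\<close>)
  thus ?thesis
    using policy_asymp policy_deriv_asymp by (simp add: \<mu>_def F)
qed

end
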